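(* Let \(\mathcal L\subset \mathbb R^n\) be a full-rank integral lattice, \(n\ge 1\), and let \(k\ge 1\) be an integer. Then \[ N_{=k}(\mathcal L)= 2\binom{n+2k-2}{2k-1} \] holds if and only if one of the following mutually exclusive cases occurs: (i) \(n=1\), say \(\mathcal L=a\mathbb Z\) with \(a>0\) and \(a^2\in\mathbb Z\), and there exists \(m\in\mathbb Z\) with \(a^2m^2=k\) (equivalently, the one-dimensional lattice \(\mathcal L\) represents \(k\)); (ii) \(n\ge 2\), \(k=1\), and \(\mathcal L\) is isometric to \(\mathbb Z^n\); (iii) \(n=8\), \(k=2\), and \(\mathcal L\) is isometric to the \(E_8\) root lattice.
   Context: A lattice \(\mathcal L\subset\mathbb R^n\) is integral if \(\langle x,y\rangle\in\mathbb Z\) for all \(x,y\in\mathcal L\) (standard Euclidean inner product). For a positive integer \(k\), \(N_{=k}(\mathcal L)\) denotes the number of vectors \(y\in\mathcal L\) with \(\|y\|^2=k\). It is known (Regev–Stephens-Davidowitz) that always \(N_{=k}(\mathcal L)\le 2\binom{n+2k-2}{2k-1}\) for full-rank integral lattices. *)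

theory Defs
  imports "HOL-Analysis.Analysis"
begin

definition int_span :: "'a::real_vector set \<Rightarrow> 'a set" where
  "int_span B = {\<Sum>b\<in>B. of_int (c b) *\<^sub>R b | c :: 'a \<Rightarrow> int. True}"

text \<open>In a Euclidean space every linearly independent set is finite, so the sum in
  \<^const>\<open>int_span\<close> is a genuine finite sum here.\<close>

definition is_lattice :: "'a::euclidean_space set \<Rightarrow> bool" where
  "is_lattice L \<longleftrightarrow> (\<exists>B. independent B \<and> L = int_span B)"

definition full_rank :: "'a::euclidean_space set \<Rightarrow> bool" where
  "full_rank L \<longleftrightarrow> span L = UNIV"

definition integral_lattice :: "'a::euclidean_space set \<Rightarrow> bool" where
  "integral_lattice L \<longleftrightarrow> is_lattice L \<and> (\<forall>x\<in>L. \<forall>y\<in>L. x \<bullet> y \<in> \<int>)"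

definition num_vectors :: "'a::euclidean_space set \<Rightarrow> nat \<Rightarrow> nat" where
  "num_vectors L k = card {y \<in> L. (norm y)\<^sup>2 = real k}"

definition represents :: "'a::euclidean_space set \<Rightarrow> nat \<Rightarrow> bool" where
  "represents L k \<longleftrightarrow> (\<exists>y\<in>L. (norm y)\<^sup>2 = real k)"

text \<open>The two ambient types may differ, so that a lattice in \<^typ>\<open>real ^ 'n\<close> with
  \<open>CARD('n) = 8\<close> can be compared with one in \<^typ>\<open>real ^ 8\<close>.\<close>

definition isometric :: "'a::euclidean_space set \<Rightarrow> 'b::euclidean_space set \<Rightarrow> bool" where
  "isometric L M \<longleftrightarrow>
     (\<exists>f. linear f \<and> (\<forall>x y. f x \<bullet> f y = x \<bullet> y) \<and> f ` L = M)"

definition Z_lattice :: "(real ^ 'n) set" where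
  "Z_lattice = {x. \<forall>i. x $ i \<in> \<int>}"

definition E8_lattice :: "(real ^ 8) set" where
  "E8_lattice = {x. ((\<forall>i. x $ i \<in> \<int>) \<or> (\<forall>i. x $ i - 1 / 2 \<in> \<int>)) \<and>
                    (\<exists>m::int. (\<Sum>i\<in>UNIV. x $ i) = 2 * of_int m)}"

text \<open>When \<open>CARD('n) = 1\<close>, \<^const>\<open>vec\<close> is the canonical identification of the real
  line with \<^typ>\<open>real ^ 'n\<close>, and the set below is \<open>a\<int>\<close>.\<close>

definition line_lattice :: "real \<Rightarrow> (real ^ 'n) set" where
  "line_lattice a = range (\<lambda>m::int. vec (a * of_int m))"

definition case_line :: "(real ^ 'n) set \<Rightarrow> nat \<Rightarrow> bool" where
  "case_line L k \<longleftrightarrow> CARD('n) = 1 \<and>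
     (\<exists>a>0. a\<^sup>2 \<in> \<int> \<and> L = line_lattice a \<and> (\<exists>m::int. a\<^sup>2 * (of_int m)\<^sup>2 = real k))"

definition case_Zn :: "(real ^ 'n) set \<Rightarrow> nat \<Rightarrow> bool" where
  "case_Zn L k \<longleftrightarrow> CARD('n) \<ge> 2 \<and> k = 1 \<and> isometric L (Z_lattice :: (real ^ 'n) set)"

definition case_E8 :: "(real ^ 'n) set \<Rightarrow> nat \<Rightarrow> bool" where
  "case_E8 L k \<longleftrightarrow> CARD('n) = 8 \<and> k = 2 \<and> isometric L E8_lattice"

end

theory Submission
  imports Defs "HOL-Library.Multiset" "HOL-Computational_Algebra.Polynomial"
begin

text \<open>
  Let \<open>X\<close> be the set of norm-\<open>k\<close> vectors, \<open>Y\<close> one half of it, \<open>m = 2k - 1\<close> and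
  \<open>F(t) = t \<Prod>\<^bsub>0<j<k\<^esub> (t\<^sup>2 - j\<^sup>2)\<close>. Inner products of vectors of \<open>Y\<close> are integers, so the functions
  \<open>x \<mapsto> F(y \<bullet> x)\<close> are dual to evaluation on \<open>Y\<close>; the bound is the dimension of the space of
  homogeneous polynomials of degree \<open>m\<close>, and equality means that these functions are a basis. Expanding
  \<open>(x \<bullet> u)\<^sup>m\<close> in the rotated bases shows that \<open>\<Sum>\<^bsub>y\<in>Y\<^esub> (y \<bullet> u)\<^bsup>2m\<^esup>\<close> is rotation invariant, and by
  applying the Laplacian so are all lower even moments, i.e. \<open>X\<close> is a spherical \<open>2m\<close>-design. A
  Sturm--Liouville argument with this design then forces \<open>F\<close> to satisfy the Gegenbauer differential
  equation if \<open>n, k \<ge> 2\<close>; at \<open>t = 1\<close> that equation reads \<open>2(k + 1)(2k - 1) = k(n + 1)\<close>, so \<open>k\<close> divides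
  \<open>2\<close> and \<open>(k, n) = (2, 8)\<close>. In that case the second and fourth moments produce, from two orthogonal
  roots \<open>a\<close>, \<open>b\<close> and the twelve roots having inner product \<open>1\<close> with both, an orthonormal frame whose \<open>D\<^sub>8\<close>
  lattice is contained in the given lattice, and a root with half-integral coordinates.
\<close>


section \<open>Homogeneous functions and interpolation on the sphere\<close>

text \<open>Gaussian elimination, one column \<open>j\<close> at a time. The rows form an indexed
  family rather than a set, so coinciding rows still count separately.\<close>

lemma nontrivial_relation:
  fixes a :: "'i \<Rightarrow> 'j \<Rightarrow> real"
  assumes "finite J" "finite I" "card J < card I"
  shows "\<exists>c. (\<exists>i\<in>I. c i \<noteq> 0) \<and> (\<forall>j\<in>J. (\<Sum>i\<in>I. c i * a i j) = 0)"
  using assms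
proof (induction J arbitrary: I a rule: finite_induct)
  case empty
  then obtain i where "i \<in> I" by fastforce
  then show ?case by (intro exI[of _ "\<lambda>_. 1"]) auto
next
  case (insert j J)
  show ?case
  proof (cases "\<forall>i\<in>I. a i j = 0")
    case True
    obtain c where "\<exists>i\<in>I. c i \<noteq> 0" "\<forall>j\<in>J. (\<Sum>i\<in>I. c i * a i j) = 0"
      using insert.IH[of I a] insert.prems insert.hyps by auto
    with True show ?thesis by (intro exI[of _ c]) auto
  next
    case False
    then obtain p where p: "p \<in> I" "a p j \<noteq> 0" by blast
    \<comment> \<open>Subtracting multiples of the pivot row \<open>p\<close> clears column
      \<open>j\<close>; the remaining rows still outnumber the remaining columns.\<close>
    define a' where "a' i l = a i l - a i j / a p j * a p l" for i l
    have "card J < card (I - {p})"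
      using insert.prems insert.hyps p by simp
    then obtain c where c: "\<exists>i\<in>I-{p}. c i \<noteq> 0"
        "\<forall>l\<in>J. (\<Sum>i\<in>I-{p}. c i * a' i l) = 0"
      using insert.IH[of "I - {p}" a'] insert.prems by auto
    \<comment> \<open>The coefficient of the pivot row is the one that makes column \<open>j\<close>
      sum to zero.\<close>
    define s where "s = - (\<Sum>i\<in>I-{p}. c i * a i j) / a p j"
    define d where "d i = (if i = p then s else c i)" for i
    have split: "(\<Sum>i\<in>I. d i * a i l) = s * a p l + (\<Sum>i\<in>I-{p}. c i * a i l)" for l
      using insert.prems p
      by (subst sum.remove[of I p]) (auto simp: d_def intro!: sum.cong)
    have "(\<Sum>i\<in>I. d i * a i l) = (\<Sum>i\<in>I-{p}. c i * a' i l)" for l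
      unfolding split a'_def s_def
      by (simp add: algebra_simps sum_subtractf sum_distrib_left sum_distrib_right sum_divide_distrib)
    moreover have "(\<Sum>i\<in>I. d i * a i j) = 0"
      using p by (simp add: split s_def)
    moreover have "\<exists>i\<in>I. d i \<noteq> 0" using c(1) by (auto simp: d_def)
    ultimately show ?thesis using c(2) by (intro exI[of _ d]) auto
  qed
qed

text \<open>Homogeneous polynomial functions of degree \<open>m\<close>. Monomials are indexed by
  multisets of basis vectors, so counting the indices bounds the dimension by
  \<open>(DIM('a) + m - 1) choose m\<close>.\<close>

definition hom_span :: "nat \<Rightarrow> ('a::euclidean_space \<Rightarrow> real) set" where
  "hom_span m = {h. \<exists>b. \<forall>x. h x = (\<Sum>M\<in>multisets_of_size Basis m. b M * (\<Prod>e\<in>#M. x \<bullet> e))}"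

lemma hom_span_add: "f \<in> hom_span m \<Longrightarrow> g \<in> hom_span m \<Longrightarrow> (\<lambda>x. f x + g x) \<in> hom_span m"
proof -
  assume "f \<in> hom_span m" "g \<in> hom_span m"
  then obtain b b' where
    "\<forall>x. f x = (\<Sum>M\<in>multisets_of_size Basis m. b M * (\<Prod>e\<in>#M. x \<bullet> e))"
    "\<forall>x. g x = (\<Sum>M\<in>multisets_of_size Basis m. b' M * (\<Prod>e\<in>#M. x \<bullet> e))"
    unfolding hom_span_def by blast
  then show ?thesis unfolding hom_span_def
    by (intro CollectI exI[of _ "\<lambda>M. b M + b' M"]) (simp add: algebra_simps sum.distrib)
qed

lemma hom_span_cmult: "f \<in> hom_span m \<Longrightarrow> (\<lambda>x. r * f x) \<in> hom_span m"
proof -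
  assume "f \<in> hom_span m"
  then obtain b where
    "\<forall>x. f x = (\<Sum>M\<in>multisets_of_size Basis m. b M * (\<Prod>e\<in>#M. x \<bullet> e))"
    unfolding hom_span_def by blast
  then show ?thesis unfolding hom_span_def
    by (intro CollectI exI[of _ "\<lambda>M. r * b M"]) (simp add: algebra_simps sum_distrib_left)
qed

lemma hom_span_zero: "(\<lambda>x. 0) \<in> hom_span m"
  unfolding hom_span_def by (intro CollectI exI[of _ "\<lambda>M. 0"]) simp

lemma hom_span_sum: "(\<And>i. i \<in> I \<Longrightarrow> f i \<in> hom_span m) \<Longrightarrow> (\<lambda>x. \<Sum>i\<in>I. f i x) \<in> hom_span m"
  by (induction I rule: infinite_finite_induct) (auto simp: hom_span_zero intro: hom_span_add)

lemma hom_span_Basis_mult: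
  assumes "f \<in> hom_span m" "e \<in> Basis"
  shows "(\<lambda>x. (x \<bullet> e) * f x) \<in> hom_span (Suc m)"
proof -
  from assms obtain b where
    b: "\<And>x. f x = (\<Sum>M\<in>multisets_of_size Basis m. b M * (\<Prod>e\<in>#M. x \<bullet> e))"
    unfolding hom_span_def by blast
  define S :: "'a multiset set" where "S = multisets_of_size Basis (Suc m)"
  have mono: "(\<lambda>x. (x \<bullet> e) * (\<Prod>e\<in>#M. x \<bullet> e)) \<in> hom_span (Suc m)"
    if "M \<in> multisets_of_size Basis m" for M
  proof -
    \<comment> \<open>The monomial of \<open>M\<close> times the coordinate along \<open>e\<close>
      is the monomial of \<open>add_mset e M\<close>.\<close>
    have mem: "add_mset e M \<in> S" using that assms(2) by (auto simp: S_def multisets_of_size_def)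
    have "finite S" by (simp add: S_def finite_multisets_of_size)
    then have "(x \<bullet> e) * (\<Prod>e\<in>#M. x \<bullet> e) =
        (\<Sum>N\<in>S. (if N = add_mset e M then 1 else 0) * (\<Prod>e\<in>#N. x \<bullet> e))" for x
      using mem by (simp add: if_distrib[of "\<lambda>z. z * _"] sum.delta' cong: if_cong)
    then show ?thesis unfolding hom_span_def S_def
      by (intro CollectI exI[of _ "\<lambda>N. if N = add_mset e M then 1 else 0"]) simp
  qed
  have "(\<lambda>x. \<Sum>M\<in>multisets_of_size Basis m. b M * ((x \<bullet> e) * (\<Prod>e\<in>#M. x \<bullet> e))) \<in> hom_span (Suc m)"
    by (intro hom_span_sum hom_span_cmult mono)
  then show ?thesis by (simp add: b sum_distrib_left algebra_simps)
qed

lemma hom_span_inner_mult: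
  assumes "f \<in> hom_span m"
  shows "(\<lambda>x. (x \<bullet> u) * f x) \<in> hom_span (Suc m)"
proof -
  have "(\<lambda>x. \<Sum>e\<in>Basis. (u \<bullet> e) * ((x \<bullet> e) * f x)) \<in> hom_span (Suc m)"
    by (intro hom_span_sum hom_span_cmult hom_span_Basis_mult assms)
  moreover have "(x \<bullet> u) * f x = (\<Sum>e\<in>Basis. (u \<bullet> e) * ((x \<bullet> e) * f x))" for x
    by (subst euclidean_inner) (simp add: sum_distrib_left mult_ac)
  ultimately show ?thesis by simp
qed

lemma hom_span_norm_mult:
  assumes "f \<in> hom_span m"
  shows "(\<lambda>x. (x \<bullet> x) * f x) \<in> hom_span (Suc (Suc m))"
proof -
  have "(\<lambda>x. \<Sum>e\<in>Basis. (x \<bullet> e) * ((x \<bullet> e) * f x)) \<in> hom_span (Suc (Suc m))"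
    by (intro hom_span_sum hom_span_Basis_mult assms)
  moreover have "(x \<bullet> x) * f x = (\<Sum>e\<in>Basis. (x \<bullet> e) * ((x \<bullet> e) * f x))" for x
    by (subst euclidean_inner) (simp add: sum_distrib_left mult_ac)
  ultimately show ?thesis by simp
qed

lemma hom_span_inner_power: "(\<lambda>x. (x \<bullet> u) ^ j * (x \<bullet> x) ^ i) \<in> hom_span (j + 2 * i)"
proof (induction i)
  case 0
  show ?case
  proof (induction j)
    case 0
    show ?case unfolding hom_span_def by (intro CollectI exI[of _ "\<lambda>_. 1"]) simp
  next
    case (Suc j)
    show ?case using hom_span_inner_mult[OF Suc, of u] by (simp add: mult_ac)
  qed
next
  case (Suc i)
  show ?case using hom_span_norm_mult[OF Suc] by (simp add: mult_ac)
qed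

definition odd_poly :: "real poly \<Rightarrow> bool" where
  "odd_poly p \<longleftrightarrow> (\<forall>i. coeff p i \<noteq> 0 \<longrightarrow> odd i)"

definition even_poly :: "real poly \<Rightarrow> bool" where
  "even_poly p \<longleftrightarrow> (\<forall>i. coeff p i \<noteq> 0 \<longrightarrow> even i)"

text \<open>Homogenisation: on the sphere \<open>x \<bullet> x = r\<close> a term of degree
  \<open>j\<close> may be multiplied by \<open>(x \<bullet> x / r) ^ ((m - j) div 2)\<close>, which
  is 1 there. Oddness of \<open>f\<close> and of \<open>m\<close> makes \<open>m - j\<close> even
  whenever the coefficient is nonzero.\<close>

lemma odd_poly_on_sphere:
  assumes "odd_poly f" "degree f \<le> m" "odd m" "r \<noteq> 0"
  shows "\<exists>h\<in>hom_span m. \<forall>x. x \<bullet> x = r \<longrightarrow> h x = poly f (x \<bullet> u)"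
proof -
  define h where
    "h x = (\<Sum>j\<le>degree f. (coeff f j / r ^ ((m - j) div 2)) * ((x \<bullet> u) ^ j * (x \<bullet> x) ^ ((m - j) div 2)))" for x
  have summand: "(\<lambda>x. (coeff f j / r ^ ((m - j) div 2)) * ((x \<bullet> u) ^ j * (x \<bullet> x) ^ ((m - j) div 2))) \<in> hom_span m"
    if "j \<le> degree f" for j
  proof (cases "coeff f j = 0")
    case True
    then show ?thesis using hom_span_zero by simp
  next
    case False
    then have "odd j" using assms by (auto simp: odd_poly_def)
    then have "even (m - j)" "j \<le> m" using assms that by auto
    then have "j + 2 * ((m - j) div 2) = m" by simp
    then show ?thesis
      using hom_span_cmult[OF hom_span_inner_power[of u j "(m - j) div 2"], of "coeff f j / r ^ ((m - j) div 2)"]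
      by (simp only:)
  qed
  have "h \<in> hom_span m" unfolding h_def by (intro hom_span_sum summand) auto
  moreover have "h x = poly f (x \<bullet> u)" if "x \<bullet> x = r" for x
    using assms(4) by (simp add: h_def that poly_altdef)
  ultimately show ?thesis by blast
qed

text \<open>The \<open>card Y\<close> functions \<open>\<phi> y\<close> are dual to evaluation at the points of \<open>Y\<close>, hence form a
  basis of a space of dimension at most \<open>card Y\<close>.\<close>

lemma hom_span_interpolation:
  fixes Y :: "'a::euclidean_space set"
  assumes "finite Y" and card: "card Y = (DIM('a) + m - 1) choose m"
    and \<phi>: "\<And>y. y \<in> Y \<Longrightarrow> \<phi> y \<in> hom_span m"
    and dual: "\<And>y z. y \<in> Y \<Longrightarrow> z \<in> Y \<Longrightarrow> \<phi> y z = (if y = z then 1 else 0)"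
    and h: "h \<in> hom_span m"
  shows "h x = (\<Sum>y\<in>Y. h y * \<phi> y x)"
proof -
  define J :: "'a multiset set" where "J = multisets_of_size Basis m"
  \<comment> \<open>\<open>None\<close> adjoins \<open>h\<close> to the functions
    \<open>\<phi> y\<close>; the enlarged family has one member more than there are monomials, so a
    linear relation exists.\<close>
  define \<psi> where "\<psi> i = (case i of None \<Rightarrow> h | Some y \<Rightarrow> \<phi> y)" for i
  define I where "I = insert None (Some ` Y)"
  have "\<exists>b. \<forall>x. \<psi> i x = (\<Sum>M\<in>J. b M * (\<Prod>e\<in>#M. x \<bullet> e))" if "i \<in> I" for i
  proof -
    have "\<psi> i \<in> hom_span m" using that h \<phi> by (auto simp: \<psi>_def I_def)
    then show ?thesis by (simp add: hom_span_def J_def)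
  qed
  then obtain a where a: "\<And>i x. i \<in> I \<Longrightarrow> \<psi> i x = (\<Sum>M\<in>J. a i M * (\<Prod>e\<in>#M. x \<bullet> e))"
    by metis
  have "finite J" by (simp add: J_def finite_multisets_of_size)
  moreover have "finite I" using assms by (simp add: I_def)
  moreover have "card J = card Y" by (simp add: J_def card_multisets_of_size card)
  then have "card J < card I" using assms by (simp add: I_def card_image)
  ultimately obtain c where c: "\<exists>i\<in>I. c i \<noteq> 0" "\<And>M. M \<in> J \<Longrightarrow> (\<Sum>i\<in>I. c i * a i M) = 0"
    using nontrivial_relation[of J I a] by blast
  have "(\<Sum>i\<in>I. c i * \<psi> i x) = 0" for x
  proof -
    have "(\<Sum>i\<in>I. c i * \<psi> i x) = (\<Sum>i\<in>I. \<Sum>M\<in>J. c i * a i M * (\<Prod>e\<in>#M. x \<bullet> e))"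
      by (rule sum.cong) (auto simp: a sum_distrib_left mult_ac)
    also have "\<dots> = (\<Sum>M\<in>J. (\<Sum>i\<in>I. c i * a i M) * (\<Prod>e\<in>#M. x \<bullet> e))"
      by (subst sum.swap) (simp add: sum_distrib_right)
    also have "\<dots> = 0" using c(2) by simp
    finally show ?thesis .
  qed
  then have rel: "c None * h x + (\<Sum>y\<in>Y. c (Some y) * \<phi> y x) = 0" for x
    using assms(1) by (simp add: I_def \<psi>_def sum.reindex image_iff)
  \<comment> \<open>Evaluating the relation at \<open>z\<close> isolates one coefficient by
    duality.\<close>
  have cy: "c (Some z) = - c None * h z" if "z \<in> Y" for z
  proof -
    have "(\<Sum>y\<in>Y. c (Some y) * \<phi> y z) = (\<Sum>y\<in>Y. if y = z then c (Some y) else 0)"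
      by (rule sum.cong) (auto simp: dual that)
    also have "\<dots> = c (Some z)" using that assms(1) by simp
    finally show ?thesis using rel[of z] by simp
  qed
  \<comment> \<open>Otherwise \<open>cy\<close> would make every coefficient vanish; hence the
    relation can be solved for \<open>h\<close>.\<close>
  have "c None \<noteq> 0"
  proof
    assume "c None = 0"
    then show False using c(1) cy by (auto simp: I_def)
  qed
  moreover have "c None * h x = c None * (\<Sum>y\<in>Y. h y * \<phi> y x)"
  proof -
    have "(\<Sum>y\<in>Y. c (Some y) * \<phi> y x) = (\<Sum>y\<in>Y. - c None * (h y * \<phi> y x))"
      by (rule sum.cong) (auto simp: cy)
    also have "\<dots> = - c None * (\<Sum>y\<in>Y. h y * \<phi> y x)" by (simp only: sum_distrib_left)
    finally show ?thesis using rel[of x] by simp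
  qed
  ultimately show ?thesis by simp
qed

section \<open>The node polynomial\<close>

lemma odd_poly_add: "odd_poly p \<Longrightarrow> odd_poly q \<Longrightarrow> odd_poly (p + q)"
  unfolding odd_poly_def by (metis add.right_neutral coeff_add)

lemma odd_poly_diff: "odd_poly p \<Longrightarrow> odd_poly q \<Longrightarrow> odd_poly (p - q)"
  unfolding odd_poly_def by (metis coeff_diff diff_zero)

lemma odd_poly_smult: "odd_poly p \<Longrightarrow> odd_poly (smult r p)"
  unfolding odd_poly_def by simp

lemma odd_poly_mult_even: "odd_poly p \<Longrightarrow> even_poly q \<Longrightarrow> odd_poly (p * q)"
  unfolding odd_poly_def even_poly_def
proof (intro allI impI)
  fix i assume *: "\<forall>i. coeff p i \<noteq> 0 \<longrightarrow> odd i" "\<forall>i. coeff q i \<noteq> 0 \<longrightarrow> even i" "coeff (p * q) i \<noteq> 0"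
  then obtain j where "j \<le> i" "coeff p j * coeff q (i - j) \<noteq> 0"
    unfolding coeff_mult by (meson atMost_iff sum.neutral)
  moreover from this have "odd j" "even (i - j)" using * by auto
  ultimately show "odd i" by simp
qed

lemma even_poly_mult_odd: "even_poly p \<Longrightarrow> odd_poly q \<Longrightarrow> odd_poly (p * q)"
  using odd_poly_mult_even by (metis mult.commute)

lemma even_poly_pderiv: "odd_poly p \<Longrightarrow> even_poly (pderiv p)"
  unfolding odd_poly_def even_poly_def coeff_pderiv by (metis even_Suc mult_eq_0_iff)

lemma odd_poly_pderiv: "even_poly p \<Longrightarrow> odd_poly (pderiv p)"
  unfolding odd_poly_def even_poly_def coeff_pderiv by (metis even_Suc mult_eq_0_iff)

lemma odd_poly_X: "odd_poly [:0, 1:]"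
  by (auto simp: odd_poly_def coeff_pCons split: nat.splits)

lemma even_poly_quadratic: "even_poly [:a, 0, b:]"
  by (auto simp: even_poly_def coeff_pCons split: nat.splits)

lemma odd_poly_monom: "odd m \<Longrightarrow> odd_poly (monom a m)"
  by (auto simp: odd_poly_def)

text \<open>For \<open>k \<ge> 1\<close> the roots are exactly the integers of absolute value less
  than \<open>k\<close>: the integral inner products possible between two norm-\<open>k\<close>
  vectors that are neither equal nor opposite.\<close>

definition node_poly :: "nat \<Rightarrow> real poly" where
  "node_poly k = [:0, 1:] * (\<Prod>j\<in>{1..<k}. [:- (real j)\<^sup>2, 0, 1:])"

lemma node_poly_Suc: "k \<ge> 1 \<Longrightarrow> node_poly (Suc k) = node_poly k * [:- (real k)\<^sup>2, 0, 1:]"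
  by (simp add: node_poly_def mult_ac)

lemma node_poly_1: "node_poly (Suc 0) = [:0, 1:]"
  by (simp add: node_poly_def)

lemma odd_node_poly: "k \<ge> 1 \<Longrightarrow> odd_poly (node_poly k)"
  by (induction k rule: dec_induct)
     (auto simp: node_poly_Suc node_poly_1 odd_poly_X simp del: mult_pCons_right
       intro!: odd_poly_mult_even even_poly_quadratic)

lemma degree_lead_node_poly:
  "k \<ge> 1 \<Longrightarrow> degree (node_poly k) = 2 * k - 1 \<and> lead_coeff (node_poly k) = 1"
proof (induction k rule: dec_induct)
  case base
  show ?case by (simp add: node_poly_1)
next
  case (step k)
  then have nz: "node_poly k \<noteq> 0" by auto
  have "degree (node_poly (Suc k)) = degree (node_poly k) + 2"
    using step.hyps nz by (simp add: node_poly_Suc degree_mult_eq del: mult_pCons_right)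
  moreover have "lead_coeff (node_poly (Suc k)) = lead_coeff (node_poly k) * 1"
    using step.hyps nz by (simp only: node_poly_Suc lead_coeff_mult) simp
  moreover have "degree (node_poly k) = 2 * k - 1" "lead_coeff (node_poly k) = 1" using step.IH by auto
  ultimately show ?case using step.hyps by (simp only: mult_1_right) arith
qed

lemma poly_node_poly_eq_0:
  assumes "t \<in> \<int>" "\<bar>t\<bar> < real k"
  shows "poly (node_poly k) t = 0"
proof -
  obtain i where i: "t = of_int i" using assms by (auto elim: Ints_cases)
  show ?thesis
  proof (cases "i = 0")
    case False
    have "nat \<bar>i\<bar> \<in> {1..<k}" using assms i False by auto
    moreover have "(real (nat \<bar>i\<bar>))\<^sup>2 = t\<^sup>2" using i by simp
    then have "poly [:- (real (nat \<bar>i\<bar>))\<^sup>2, 0, 1:] t = 0" by (simp add: power2_eq_square)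
    ultimately have "(\<Prod>j\<in>{1..<k}. poly [:- (real j)\<^sup>2, 0, 1:] t) = 0"
      by (meson finite_atLeastLessThan prod_zero)
    then show ?thesis by (simp add: node_poly_def poly_prod)
  qed (simp add: node_poly_def i)
qed

lemma poly_node_poly_pos: "k \<ge> 1 \<Longrightarrow> poly (node_poly k) (real k) > 0"
  unfolding node_poly_def poly_mult poly_prod
  by (intro mult_pos_pos prod_pos) (auto simp: power2_eq_square simp flip: of_nat_mult intro!: mult_strict_mono)

text \<open>If \<open>F(1) = 0\<close>, multiplying \<open>F\<close> by \<open>t^2 - k^2\<close>
  scales both derivatives at 1 by \<open>1 - k^2\<close> and adds \<open>4 F'(1)\<close> to the
  second, which gives their ratio by induction. The induction starts at 2, since the polynomial for
  \<open>k = 1\<close> does not vanish at 1.\<close>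

lemma node_poly_derivs_at_1:
  assumes "k \<ge> 2"
  shows "poly (pderiv (pderiv (node_poly k))) 1 * (real k * (real k - 1)) =
           2 * (2 * real k - 1) * poly (pderiv (node_poly k)) 1 \<and> poly (pderiv (node_poly k)) 1 \<noteq> 0"
  using assms
proof (induction k rule: dec_induct)
  case base
  show ?case by (simp add: numeral_2_eq_2 node_poly_Suc node_poly_1 pderiv_pCons)
next
  case (step k)
  define F where "F = node_poly k"
  have F1: "poly F 1 = 0" unfolding F_def by (rule poly_node_poly_eq_0) (use step in auto)
  have S: "node_poly (Suc k) = F * [:- (real k)\<^sup>2, 0, 1:]" using step by (simp add: node_poly_Suc F_def)
  have d1: "poly (pderiv (node_poly (Suc k))) 1 = poly (pderiv F) 1 * (1 - (real k)\<^sup>2)"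
    unfolding S pderiv_mult poly_add poly_mult by (simp add: pderiv_pCons F1 algebra_simps power2_eq_square)
  have d2: "poly (pderiv (pderiv (node_poly (Suc k)))) 1 =
      poly (pderiv (pderiv F)) 1 * (1 - (real k)\<^sup>2) + 4 * poly (pderiv F) 1"
    unfolding S pderiv_mult pderiv_add poly_add poly_mult
    by (simp add: pderiv_pCons F1 algebra_simps power2_eq_square)
  have "(real k)\<^sup>2 > 1" using step by (simp add: power2_eq_square less_1_mult)
  moreover have "poly (pderiv F) 1 \<noteq> 0" using step F_def by simp
  ultimately have "poly (pderiv (node_poly (Suc k))) 1 \<noteq> 0" unfolding d1 by simp
  moreover have "poly (pderiv (pderiv (node_poly (Suc k)))) 1 * (real (Suc k) * (real (Suc k) - 1)) =
           2 * (2 * real (Suc k) - 1) * poly (pderiv (node_poly (Suc k))) 1"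
  proof -
    define a b x where "a = poly (pderiv F) 1" and "b = poly (pderiv (pderiv F)) 1" and "x = real k"
    have IH: "b * (x * (x - 1)) = 2 * (2 * x - 1) * a" using step F_def a_def b_def x_def by simp
    \<comment> \<open>The factor \<open>(x + 1) * x\<close> and the splitting
      \<open>1 - x^2 = - (x - 1) * (x + 1)\<close> bring out the left side of
      \<open>IH\<close>.\<close>
    have "(b * (1 - x\<^sup>2) + 4 * a) * ((x + 1) * x) = - (x + 1)\<^sup>2 * (b * (x * (x - 1))) + 4 * a * (x + 1) * x"
      by (simp add: algebra_simps power2_eq_square)
    also have "\<dots> = 2 * (2 * (x + 1) - 1) * (a * (1 - x\<^sup>2))"
      unfolding IH by (simp add: algebra_simps power2_eq_square)
    finally show ?thesis unfolding d1 d2 by (simp add: a_def b_def x_def add.commute)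
  qed
  ultimately show ?case by blast
qed

section \<open>Moments\<close>

lemma pderiv_sum_eq: "pderiv (\<Sum>i\<in>I. f i) = (\<Sum>i\<in>I. pderiv (f i))"
  using higher_pderiv_sum[of 1 f I] by simp

text \<open>For \<open>N = 0\<close> the truncated exponent \<open>N - 1\<close> is harmless,
  because its term carries the factor \<open>real N\<close>.\<close>

lemma poly_pderiv2_power_Suc:
  fixes q :: "real poly"
  shows "poly (pderiv (pderiv (q ^ Suc N))) x =
    (real N + 1) * (real N * poly q x ^ (N - 1) * (poly (pderiv q) x)\<^sup>2 + poly q x ^ N * poly (pderiv (pderiv q)) x)"
proof -
  have 1: "pderiv (q ^ Suc N) = smult (real N + 1) (q ^ N * pderiv q)" for N
    by (simp only: pderiv_power_Suc mult_smult_left of_nat_Suc add.commute)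
  show ?thesis
  proof (cases N)
    case (Suc M)
    have "pderiv (pderiv (q ^ Suc (Suc M))) =
        smult (real (Suc M) + 1) (q ^ Suc M * pderiv (pderiv q) + pderiv q * smult (real M + 1) (q ^ M * pderiv q))"
      by (simp only: 1 pderiv_smult pderiv_mult)
    then show ?thesis using Suc
      by (simp only: poly_smult poly_add poly_mult poly_power) (simp add: power2_eq_square algebra_simps)
  qed (simp add: 1)
qed

text \<open>Apply the Laplacian in \<open>u\<close> to the hypothesis \<open>M\<close>. On the left
  the squares \<open>(y \<bullet> e)^2\<close> sum to \<open>r\<close>; on the right the Laplacian
  of \<open>(u \<bullet> u) ^ (p + 1)\<close> is
  \<open>2 (p + 1) (DIM('a) + 2 p) (u \<bullet> u) ^ p\<close>.\<close>

lemma moment_descent: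
  fixes Y :: "'a::euclidean_space set"
  assumes "finite Y" and norm: "\<And>y. y \<in> Y \<Longrightarrow> y \<bullet> y = r"
    and M: "\<And>u. (\<Sum>y\<in>Y. (y \<bullet> u) ^ (2 * p + 2)) = C * (u \<bullet> u) ^ (p + 1)"
  shows "r * (2 * real p + 1) * (\<Sum>y\<in>Y. (y \<bullet> u) ^ (2 * p)) = C * (DIM('a) + 2 * real p) * (u \<bullet> u) ^ p"
proof -
  have coeff: "(2 * real p + 2) * (2 * real p + 1) * (\<Sum>y\<in>Y. (y \<bullet> u) ^ (2 * p) * (y \<bullet> e)\<^sup>2) =
     C * (real p + 1) * (4 * (real p * (u \<bullet> u) ^ (p - 1)) * (u \<bullet> e)\<^sup>2 + 2 * (u \<bullet> u) ^ p)"
    if e: "e \<in> Basis" for e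
  proof -
    \<comment> \<open>The second derivative along \<open>e\<close> is taken in one variable:
      \<open>M\<close> at \<open>u + t *\<^sub>R e\<close> is an identity of polynomials in
      \<open>t\<close>, to be differentiated twice at 0.\<close>
    have eq: "(\<Sum>y\<in>Y. [:y \<bullet> u, y \<bullet> e:] ^ (2 * p + 2)) = smult C ([:u \<bullet> u, 2 * (u \<bullet> e), 1:] ^ (p + 1))"
    proof (rule poly_ext)
      fix t :: real
      have "(\<Sum>y\<in>Y. (y \<bullet> u + t * (y \<bullet> e)) ^ (2 * p + 2)) = C * ((u + t *\<^sub>R e) \<bullet> (u + t *\<^sub>R e)) ^ (p + 1)"
        using M[of "u + t *\<^sub>R e"] by (simp add: inner_add_right)
      moreover have "(u + t *\<^sub>R e) \<bullet> (u + t *\<^sub>R e) = u \<bullet> u + t * (2 * (u \<bullet> e) + t)"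
        using e by (simp add: algebra_simps inner_commute inner_Basis)
      ultimately show "poly (\<Sum>y\<in>Y. [:y \<bullet> u, y \<bullet> e:] ^ (2 * p + 2)) t =
          poly (smult C ([:u \<bullet> u, 2 * (u \<bullet> e), 1:] ^ (p + 1))) t"
        by (simp only: poly_sum poly_power poly_smult) simp
    qed
    have l: "poly (pderiv (pderiv ([:a, b:] ^ (2 * p + 2)))) 0 = (2 * real p + 2) * (2 * real p + 1) * (a ^ (2 * p) * b\<^sup>2)"
      for a b :: real
      using poly_pderiv2_power_Suc[of "[:a, b:]" "Suc (2 * p)" 0]
      by (simp add: pderiv_pCons del: power_Suc) (simp add: algebra_simps)
    have r: "poly (pderiv (pderiv ([:a, 2 * b, 1:] ^ (p + 1)))) 0 =
        (real p + 1) * (4 * (real p * a ^ (p - 1)) * b\<^sup>2 + 2 * a ^ p)" for a b :: real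
      using poly_pderiv2_power_Suc[of "[:a, 2 * b, 1:]" p 0]
      by (simp add: pderiv_pCons power_mult_distrib mult_ac del: power_Suc)
    have "poly (pderiv (pderiv (\<Sum>y\<in>Y. [:y \<bullet> u, y \<bullet> e:] ^ (2 * p + 2)))) 0 =
        (\<Sum>y\<in>Y. poly (pderiv (pderiv ([:y \<bullet> u, y \<bullet> e:] ^ (2 * p + 2)))) 0)"
      by (simp only: pderiv_sum_eq poly_sum)
    then show ?thesis
      unfolding eq l pderiv_smult poly_smult r by (simp only: sum_distrib_left mult.assoc)
  qed
  have parseval: "(\<Sum>e\<in>Basis. (x \<bullet> e)\<^sup>2) = x \<bullet> x" for x :: 'a
    by (subst euclidean_inner) (simp add: power2_eq_square)
  have "(2 * real p + 2) * (2 * real p + 1) * (\<Sum>y\<in>Y. (y \<bullet> u) ^ (2 * p) * r) =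
      (\<Sum>e\<in>Basis. (2 * real p + 2) * (2 * real p + 1) * (\<Sum>y\<in>Y. (y \<bullet> u) ^ (2 * p) * (y \<bullet> e)\<^sup>2))"
  proof -
    have "(\<Sum>y\<in>Y. (y \<bullet> u) ^ (2 * p) * r) = (\<Sum>y\<in>Y. \<Sum>e\<in>Basis. (y \<bullet> u) ^ (2 * p) * (y \<bullet> e)\<^sup>2)"
      by (rule sum.cong) (simp_all add: norm parseval flip: sum_distrib_left)
    also have "\<dots> = (\<Sum>e\<in>Basis. \<Sum>y\<in>Y. (y \<bullet> u) ^ (2 * p) * (y \<bullet> e)\<^sup>2)" by (rule sum.swap)
    finally show ?thesis by (simp only: sum_distrib_left)
  qed
  also have "\<dots> = (\<Sum>e\<in>Basis. C * (real p + 1) * (4 * (real p * (u \<bullet> u) ^ (p - 1)) * (u \<bullet> e)\<^sup>2 + 2 * (u \<bullet> u) ^ p))"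
    by (rule sum.cong) (simp_all only: coeff)
  also have "\<dots> = C * (real p + 1) * (4 * (real p * (u \<bullet> u) ^ (p - 1)) * (u \<bullet> u) + DIM('a) * (2 * (u \<bullet> u) ^ p))"
    unfolding sum_distrib_left[symmetric] sum.distrib parseval sum_constant by (simp only: mult_ac)
  \<comment> \<open>For \<open>p = 0\<close> the exponent \<open>p - 1\<close> is truncated, but the
    term is zero on both sides.\<close>
  also have "\<dots> = C * (real p + 1) * (4 * (real p * (u \<bullet> u) ^ p) + DIM('a) * (2 * (u \<bullet> u) ^ p))"
    by (cases p) simp_all
  also have "\<dots> = (2 * real p + 2) * (C * (DIM('a) + 2 * real p) * (u \<bullet> u) ^ p)"
    by (simp add: algebra_simps)
  finally have "(2 * real p + 2) * (r * (2 * real p + 1) * (\<Sum>y\<in>Y. (y \<bullet> u) ^ (2 * p))) =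
      (2 * real p + 2) * (C * (DIM('a) + 2 * real p) * (u \<bullet> u) ^ p)"
    by (simp add: sum_distrib_left[symmetric] mult_ac)
  then show ?thesis by simp
qed

section \<open>Extremal configurations\<close>

text \<open>\<open>Y\<close> contains one vector of each antipodal pair of norm-\<open>k\<close> vectors.\<close>

locale extremal_half =
  fixes Y :: "(real ^ 'n) set" and k :: nat
  assumes k_pos: "k \<ge> 1"
    and finite_Y: "finite Y"
    and card_Y: "card Y = (CARD('n) + 2 * k - 2) choose (2 * k - 1)"
    and norm_Y: "y \<in> Y \<Longrightarrow> y \<bullet> y = real k"
    and inner_Y: "y \<in> Y \<Longrightarrow> z \<in> Y \<Longrightarrow> y \<bullet> z \<in> \<int>"
    and antipodal_Y: "y \<in> Y \<Longrightarrow> - y \<notin> Y"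
begin

abbreviation "F \<equiv> node_poly k"
abbreviation "c \<equiv> poly F (real k)"

lemma c_pos: "c > 0" using poly_node_poly_pos[OF k_pos] .

lemma inner_bound:
  assumes "x \<bullet> x = real k" "y \<bullet> y = real k"
  shows "\<bar>x \<bullet> y\<bar> \<le> real k"
proof -
  have "\<bar>x \<bullet> y\<bar> \<le> norm x * norm y" by (rule Cauchy_Schwarz_ineq2)
  also have "\<dots> = real k" using assms by (simp add: norm_eq_sqrt_inner)
  finally show ?thesis .
qed

lemma inner_less:
  assumes "x \<in> Y" "y \<in> Y" "x \<noteq> y"
  shows "\<bar>x \<bullet> y\<bar> < real k"
proof -
  have "x \<noteq> - y" using antipodal_Y assms by auto
  then have "(x - y) \<bullet> (x - y) > 0" "(x + y) \<bullet> (x + y) > 0"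
    using assms by (auto simp: add_eq_0_iff)
  then show ?thesis
    using norm_Y[OF assms(1)] norm_Y[OF assms(2)] by (simp add: algebra_simps inner_commute)
qed

text \<open>Distinct vectors of \<open>Y\<close> have an integral inner product strictly between
  \<open>-k\<close> and \<open>k\<close>, a root of \<open>F\<close>; so the matrix
  \<open>F (x \<bullet> y)\<close> is \<open>c\<close> times the identity.\<close>

lemma poly_F_Y: "x \<in> Y \<Longrightarrow> y \<in> Y \<Longrightarrow> poly F (x \<bullet> y) = (if x = y then c else 0)"
  by (auto simp: norm_Y intro!: poly_node_poly_eq_0 inner_Y inner_less)

lemma odd_F: "odd_poly F" using k_pos by (rule odd_node_poly)

lemma degree_F: "degree F = 2 * k - 1" and lead_F: "lead_coeff F = 1"
  using degree_lead_node_poly[OF k_pos] by auto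

text \<open>By \<open>poly_F_Y\<close> the functions \<open>F (y \<bullet> x) / c\<close> are dual
  to evaluation on \<open>Y\<close>, and \<open>card_Y\<close> is the dimension count for degree
  \<open>2 * k - 1\<close>, so interpolation at \<open>Y\<close> is exact on the sphere.
  Homogenisation turns the odd polynomials into members of \<open>hom_span\<close>.\<close>

lemma interpolation:
  assumes "odd_poly f" "degree f \<le> 2 * k - 1" "x \<bullet> x = real k"
  shows "c * poly f (x \<bullet> u) = (\<Sum>y\<in>Y. poly f (y \<bullet> u) * poly F (y \<bullet> x))"
proof -
  have m: "odd (2 * k - 1)" "real k \<noteq> 0" using k_pos by auto
  obtain h where h: "h \<in> hom_span (2 * k - 1)" "\<And>x. x \<bullet> x = real k \<Longrightarrow> h x = poly f (x \<bullet> u)"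
    using odd_poly_on_sphere[OF assms(1,2) m] by blast
  have "\<forall>y :: real ^ 'n. \<exists>g. g \<in> hom_span (2 * k - 1) \<and> (\<forall>x. x \<bullet> x = real k \<longrightarrow> g x = poly F (x \<bullet> y))"
    using odd_poly_on_sphere[OF odd_F eq_imp_le[OF degree_F] m] by blast
  from choice[OF this] obtain g where
    "\<forall>y :: real ^ 'n. g y \<in> hom_span (2 * k - 1) \<and> (\<forall>x. x \<bullet> x = real k \<longrightarrow> g y x = poly F (x \<bullet> y))" ..
  then have g: "g y \<in> hom_span (2 * k - 1)" "x \<bullet> x = real k \<Longrightarrow> g y x = poly F (x \<bullet> y)"
    for x y :: "real ^ 'n" by auto
  have "h x = (\<Sum>y\<in>Y. h y * (inverse c * g y x))"
  proof (rule hom_span_interpolation[OF finite_Y _ _ _ h(1)])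
    show "card Y = DIM(real ^ 'n) + (2 * k - 1) - 1 choose (2 * k - 1)"
      using k_pos by (simp add: card_Y numeral_2_eq_2)
    show "(\<lambda>x. inverse c * g y x) \<in> hom_span (2 * k - 1)" for y
      by (intro hom_span_cmult g)
    show "inverse c * g y z = (if y = z then 1 else 0)" if "y \<in> Y" "z \<in> Y" for y z
      using that c_pos poly_F_Y[of z y] by (auto simp: g(2) norm_Y)
  qed
  also have "\<dots> = (\<Sum>y\<in>Y. poly f (y \<bullet> u) * (inverse c * poly F (y \<bullet> x)))"
    by (rule sum.cong) (auto simp: h(2) g(2) norm_Y assms(3) inner_commute)
  also have "\<dots> = inverse c * (\<Sum>y\<in>Y. poly f (y \<bullet> u) * poly F (y \<bullet> x))"
    by (simp add: sum_distrib_left mult_ac)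
  finally show ?thesis using c_pos h(2)[OF assms(3)] by (simp add: field_simps)
qed

text \<open>For an orthogonal \<open>T\<close> the matrix \<open>F (y \<bullet> T z) / c\<close> is orthogonal and expresses the powers
  \<open>(T z \<bullet> u) ^ (2 * k - 1)\<close> through the powers \<open>(y \<bullet> u) ^ (2 * k - 1)\<close>.\<close>

lemma moment_rotation:
  assumes "orthogonal_transformation T"
  shows "(\<Sum>z\<in>Y. (T z \<bullet> u) ^ (2 * (2 * k - 1))) = (\<Sum>y\<in>Y. (y \<bullet> u) ^ (2 * (2 * k - 1)))"
proof -
  define m where "m = 2 * k - 1"
  have m: "odd m" using k_pos by (simp add: m_def)
  \<comment> \<open>\<open>T'\<close> is the adjoint of \<open>T\<close>; it moves the rotation to
    the other argument of the inner product.\<close>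
  define T' where "T' = inv T"
  have T': "orthogonal_transformation T'"
    using assms by (simp add: T'_def orthogonal_transformation_inv)
  have adj: "y \<bullet> T z = z \<bullet> T' y" for y z
  proof -
    have "y = T (T' y)"
      using orthogonal_transformation_surj[OF assms] by (simp add: T'_def surj_f_inv_f)
    then show ?thesis
      using assms by (metis inner_commute orthogonal_transformation_def)
  qed
  have nT: "T z \<bullet> T z = z \<bullet> z" "T' z \<bullet> T' w = z \<bullet> w" for z w
    using assms T' by (auto simp: orthogonal_transformation_def)
  define A where "A y z = poly F (y \<bullet> T z)" for y z
  have expand: "c * (T z \<bullet> u) ^ m = (\<Sum>y\<in>Y. (y \<bullet> u) ^ m * A y z)" if "z \<in> Y" for z
    using interpolation[of "monom 1 m" "T z" u] that m
    by (simp add: odd_poly_monom m_def poly_monom degree_monom_eq nT norm_Y A_def)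
  \<comment> \<open>Row orthogonality of \<open>A\<close> is the interpolation formula for
    \<open>F\<close> itself, at the point \<open>T' w\<close> with direction
    \<open>T' y\<close>.\<close>
  have orth: "(\<Sum>z\<in>Y. A y z * A w z) = (if y = w then c * c else 0)" if "y \<in> Y" "w \<in> Y" for y w
  proof -
    have "(\<Sum>z\<in>Y. A y z * A w z) = c * poly F (T' w \<bullet> T' y)"
      using interpolation[OF odd_F _ , of "T' w" "T' y"] degree_F that
      by (simp add: A_def adj nT norm_Y)
    then show ?thesis using that poly_F_Y[of w y] by (auto simp: nT)
  qed
  have square: "t ^ (2 * m) = t ^ m * t ^ m" for t :: real by (simp add: mult_2 power_add)
  have "c * c * (\<Sum>z\<in>Y. (T z \<bullet> u) ^ (2 * m)) = (\<Sum>z\<in>Y. (c * (T z \<bullet> u) ^ m) * (c * (T z \<bullet> u) ^ m))"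
    unfolding square by (simp add: sum_distrib_left mult_ac)
  also have "\<dots> = (\<Sum>z\<in>Y. (\<Sum>y\<in>Y. (y \<bullet> u) ^ m * A y z) * (\<Sum>w\<in>Y. (w \<bullet> u) ^ m * A w z))"
    by (rule sum.cong) (simp_all add: expand)
  also have "\<dots> = (\<Sum>z\<in>Y. \<Sum>y\<in>Y. \<Sum>w\<in>Y. (y \<bullet> u) ^ m * (w \<bullet> u) ^ m * (A y z * A w z))"
    by (simp add: sum_product mult_ac)
  also have "\<dots> = (\<Sum>y\<in>Y. \<Sum>w\<in>Y. \<Sum>z\<in>Y. (y \<bullet> u) ^ m * (w \<bullet> u) ^ m * (A y z * A w z))"
    by (subst sum.swap, rule sum.cong[OF refl], rule sum.swap)
  also have "\<dots> = (\<Sum>y\<in>Y. \<Sum>w\<in>Y. if y = w then (y \<bullet> u) ^ m * (w \<bullet> u) ^ m * (c * c) else 0)"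
    by (intro sum.cong refl) (simp add: sum_distrib_left[symmetric] orth)
  also have "\<dots> = c * c * (\<Sum>y\<in>Y. (y \<bullet> u) ^ (2 * m))"
    unfolding square using finite_Y by (simp add: sum_distrib_left mult_ac)
  finally show ?thesis using c_pos by (simp add: m_def)
qed

text \<open>A rotation takes \<open>u\<close> to a multiple of a fixed unit vector, so by
  \<open>moment_rotation\<close> the sum depends only on the length of \<open>u\<close>; homogeneity
  gives the power.\<close>

lemma top_moment: "\<exists>C. \<forall>u. (\<Sum>y\<in>Y. (y \<bullet> u) ^ (2 * (2 * k - 1))) = C * (u \<bullet> u) ^ (2 * k - 1)"
proof -
  define m where "m = 2 * k - 1"
  have m: "m \<ge> 1" using k_pos by (simp add: m_def)
  define M where "M u = (\<Sum>y\<in>Y. (y \<bullet> u) ^ (2 * m))" for u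
  define e :: "real ^ 'n" where "e = axis undefined 1"
  have "M u = M e * (u \<bullet> u) ^ m" for u
  proof -
    have "norm u = norm (norm u *\<^sub>R e)" by (simp add: e_def)
    then obtain T where T: "orthogonal_transformation T" "T u = norm u *\<^sub>R e"
      using orthogonal_transformation_exists by blast
    have "M u = (\<Sum>y\<in>Y. (T y \<bullet> T u) ^ (2 * m))"
      using T(1) by (simp add: M_def orthogonal_transformation_def)
    also have "\<dots> = M (T u)" unfolding M_def m_def by (rule moment_rotation[OF T(1)])
    also have "\<dots> = M e * (norm u) ^ (2 * m)"
      unfolding M_def T(2) inner_scaleR_right power_mult_distrib sum_distrib_left[symmetric] by (rule mult.commute)
    also have "(norm u) ^ (2 * m) = (u \<bullet> u) ^ m" by (simp only: power_mult power2_norm_eq_inner)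
    finally show ?thesis .
  qed
  then show ?thesis unfolding M_def m_def by blast
qed

text \<open>\<open>moment_descent\<close> lowers \<open>p\<close> by one, so the induction runs
  downward from \<open>top_moment\<close>.\<close>

lemma moments:
  assumes "p \<le> 2 * k - 1"
  shows "\<exists>C. \<forall>u. (\<Sum>y\<in>Y. (y \<bullet> u) ^ (2 * p)) = C * (u \<bullet> u) ^ p"
  using assms
proof (induction p rule: inc_induct)
  case base
  show ?case by (rule top_moment)
next
  case (step p)
  then obtain C where C: "\<And>u. (\<Sum>y\<in>Y. (y \<bullet> u) ^ (2 * p + 2)) = C * (u \<bullet> u) ^ (p + 1)"
    by (auto simp del: power_Suc)
  let ?r = "real k * (2 * real p + 1)"
  have "?r * (\<Sum>y\<in>Y. (y \<bullet> u) ^ (2 * p)) = C * (real CARD('n) + 2 * real p) * (u \<bullet> u) ^ p" for u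
    using moment_descent[OF finite_Y norm_Y C] by simp
  moreover have "?r > 0" using k_pos by simp
  ultimately have "(\<Sum>y\<in>Y. (y \<bullet> u) ^ (2 * p)) = (C * (real CARD('n) + 2 * real p) / ?r) * (u \<bullet> u) ^ p" for u
    by (simp add: field_simps)
  then show ?case by blast
qed

text \<open>Eliminating the unknown constant \<open>C\<close> links consecutive even moments, so
  that they can all be computed from \<open>card Y\<close>.\<close>

lemma moment_recursion:
  assumes "p + 1 \<le> 2 * k - 1"
  shows "real k * (2 * real p + 1) * (\<Sum>y\<in>Y. (y \<bullet> u) ^ (2 * p)) * (u \<bullet> u) =
    (real CARD('n) + 2 * real p) * (\<Sum>y\<in>Y. (y \<bullet> u) ^ (2 * p + 2))"
proof -
  obtain C where C: "\<And>u. (\<Sum>y\<in>Y. (y \<bullet> u) ^ (2 * p + 2)) = C * (u \<bullet> u) ^ (p + 1)"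
    using moments[OF assms] by (auto simp del: power_Suc)
  have "real k * (2 * real p + 1) * (\<Sum>y\<in>Y. (y \<bullet> u) ^ (2 * p)) = C * (real CARD('n) + 2 * real p) * (u \<bullet> u) ^ p"
    using moment_descent[OF finite_Y norm_Y C] by simp
  then show ?thesis unfolding C by (simp add: algebra_simps)
qed

text \<open>For \<open>n = CARD('n) \<ge> 2\<close>, up to the weight
  \<open>(k^2 - t^2) powr ((n - 3) / 2)\<close> of the projected sphere measure, the summand is the
  derivative of \<open>(k^2 - t^2) powr ((n - 1) / 2) * g(t)\<close> and so has mean zero. In terms
  of moments this is \<open>moment_recursion\<close>, one monomial of \<open>g\<close> at a time;
  the degree bound keeps within the moments available.\<close>

lemma first_order_identity:
  assumes "odd_poly g" "degree g \<le> 2 * (2 * k - 1) - 1" "z \<bullet> z = real k"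
  shows "(\<Sum>y\<in>Y. ((real k)\<^sup>2 - (y \<bullet> z)\<^sup>2) * poly (pderiv g) (y \<bullet> z)
            - (real CARD('n) - 1) * (y \<bullet> z) * poly g (y \<bullet> z)) = 0"
proof -
  define \<Lambda> where "\<Lambda> g = (\<Sum>y\<in>Y. ((real k)\<^sup>2 - (y \<bullet> z)\<^sup>2) * poly (pderiv g) (y \<bullet> z)
            - (real CARD('n) - 1) * (y \<bullet> z) * poly g (y \<bullet> z))" for g
  have "\<Lambda> (p + q) = \<Lambda> p + \<Lambda> q" for p q
    unfolding \<Lambda>_def sum.distrib[symmetric]
    by (rule sum.cong) (simp_all add: pderiv_add algebra_simps)
  moreover have "\<Lambda> 0 = 0" by (simp add: \<Lambda>_def)
  ultimately have sum: "\<Lambda> (\<Sum>i\<in>I. f i) = (\<Sum>i\<in>I. \<Lambda> (f i))" for f and I :: "nat set"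
    by (induction I rule: infinite_finite_induct) auto
  have monom: "\<Lambda> (monom a i) = 0" if "a \<noteq> 0 \<longrightarrow> odd i" "i \<le> 2 * (2 * k - 1) - 1" for a i
  proof (cases "a = 0")
    case False
    then have "odd i" using that by simp
    then obtain p where p: "i = 2 * p + 1" by (rule oddE)
    have "p + 1 \<le> 2 * k - 1" using that p k_pos by linarith
    note rec = moment_recursion[OF this, of z]
    have "\<Lambda> (monom a i) = (\<Sum>y\<in>Y. a * ((real k * (2 * real p + 1) * (y \<bullet> z) ^ (2 * p)) * real k
        - (real CARD('n) + 2 * real p) * (y \<bullet> z) ^ (2 * p + 2)))"
      unfolding \<Lambda>_def p
      by (rule sum.cong) (simp_all add: pderiv_monom poly_monom power2_eq_square algebra_simps)
    also have "\<dots> = a * (real k * (2 * real p + 1) * (\<Sum>y\<in>Y. (y \<bullet> z) ^ (2 * p)) * real k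
        - (real CARD('n) + 2 * real p) * (\<Sum>y\<in>Y. (y \<bullet> z) ^ (2 * p + 2)))"
      by (simp only: sum_distrib_left[symmetric] sum_distrib_right[symmetric] sum_subtractf)
    also have "\<dots> = 0" using rec assms(3) by simp
    finally show ?thesis .
  qed (simp add: \<Lambda>_def)
  have "g = (\<Sum>i\<le>degree g. monom (coeff g i) i)" by (simp add: poly_as_sum_of_monoms)
  then have "\<Lambda> g = (\<Sum>i\<le>degree g. \<Lambda> (monom (coeff g i) i))" using sum by metis
  also have "\<dots> = 0"
    using assms by (intro sum.neutral ballI monom) (auto simp: odd_poly_def)
  finally show ?thesis by (simp add: \<Lambda>_def)
qed

end

text \<open>A unit vector orthogonal to \<open>z\<close> supplies the missing length. An identity in
  \<open>x\<close> on the sphere thereby becomes an identity in \<open>t\<close> on a whole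
  interval.\<close>

lemma exists_on_sphere_with_inner:
  fixes z :: "'a::euclidean_space"
  assumes "DIM('a) \<ge> 2" "z \<bullet> z = r" "r > 0" "\<bar>t\<bar> \<le> r"
  shows "\<exists>x. x \<bullet> x = r \<and> x \<bullet> z = t"
proof -
  obtain v0 where v0: "v0 \<noteq> 0" "orthogonal z v0"
    using orthogonal_to_vector_exists assms(1) by blast
  define v where "v = v0 /\<^sub>R norm v0"
  have v: "v \<bullet> v = 1" "z \<bullet> v = 0"
    using v0 by (auto simp: v_def orthogonal_def power2_norm_eq_inner[symmetric] power2_eq_square)
  define s where "s = sqrt (r - t\<^sup>2 / r)"
  have "t\<^sup>2 \<le> r * r" using assms abs_le_square_iff[of t r] by (simp add: power2_eq_square)
  then have s: "s * s = r - t\<^sup>2 / r" using assms by (simp add: s_def field_simps)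
  define x where "x = (t / r) *\<^sub>R z + s *\<^sub>R v"
  have "x \<bullet> x = (t / r) * (t / r) * r + s * s"
    using v assms(2) by (simp add: x_def inner_add_left inner_add_right inner_commute)
  also have "\<dots> = r" using assms by (simp add: s power2_eq_square field_simps)
  finally have "x \<bullet> x = r" .
  moreover have "x \<bullet> z = t"
    using v assms unfolding x_def inner_add_left by (simp add: inner_commute)
  ultimately show ?thesis by blast
qed

section \<open>The Gegenbauer equation for the node polynomial\<close>

context extremal_half
begin

text \<open>The differential operator annihilating the Gegenbauer polynomial of degree \<open>2 * k - 1\<close>, rescaled to
  the interval \<open>[-k, k]\<close>, applied to \<open>F\<close>.\<close>

definition defect :: "real poly" where
  "defect = [:(real k)\<^sup>2, 0, -1:] * pderiv (pderiv F)
     - smult (real CARD('n) + 1) ([:0, 1:] * pderiv F)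
     + smult (real (2 * k - 1) * (real (2 * k - 1) + real CARD('n))) F"

lemma odd_defect: "odd_poly defect"
  unfolding defect_def
  by (intro odd_poly_add odd_poly_diff odd_poly_smult odd_F odd_poly_mult_even odd_poly_X
      even_poly_pderiv even_poly_mult_odd even_poly_quadratic odd_poly_pderiv)

text \<open>With \<open>m = 2 * k - 1\<close> and \<open>n = CARD('n)\<close>, the operator sends
  \<open>t^i\<close> to \<open>(m - i) (m + i + n) t^i + k^2 i (i - 1) t^(i - 2)\<close>; the
  eigenvalue is chosen so that the first term vanishes at \<open>i = m\<close>.\<close>

lemma coeff_defect:
  "coeff defect (Suc (Suc j)) = (real k)\<^sup>2 * (real (Suc (Suc (Suc j))) * real (Suc (Suc (Suc (Suc j)))) * coeff F (Suc (Suc (Suc (Suc j)))))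
     + (real (2 * k - 1) - real (Suc (Suc j))) * (real (2 * k - 1) + real (Suc (Suc j)) + real CARD('n)) * coeff F (Suc (Suc j))"
proof -
  have "coeff ([:(real k)\<^sup>2, 0, -1:] * pderiv (pderiv F)) (Suc (Suc j)) =
     (real k)\<^sup>2 * coeff (pderiv (pderiv F)) (Suc (Suc j)) - coeff (pderiv (pderiv F)) j" by simp
  moreover have "coeff ([:0, 1:] * pderiv F) (Suc (Suc j)) = coeff (pderiv F) (Suc j)" by simp
  ultimately show ?thesis
    unfolding defect_def coeff_add coeff_diff coeff_smult by (simp add: coeff_pderiv algebra_simps)
qed

text \<open>The factor \<open>real (2 * k - 1) - i\<close> kills the coefficient of degree
  \<open>2 * k - 1\<close>, and oddness the one just below it.\<close>

lemma coeff_defect_eq_0: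
  assumes "k \<ge> 2" "i > 2 * k - 3"
  shows "coeff defect i = 0"
proof -
  have 0: "coeff F j = 0" if "j > 2 * k - 1" for j
    using that degree_F by (simp add: coeff_eq_0)
  have "i = Suc (Suc (i - 2))" using assms by linarith
  then obtain j where j: "i = Suc (Suc j)" by blast
  consider "i = 2 * k - 2" | "i = 2 * k - 1" | "i > 2 * k - 1" using assms by linarith
  then show ?thesis
  proof cases
    case 1
    then have "even i" by simp
    then show ?thesis using odd_defect by (auto simp: odd_poly_def)
  next
    case 2
    then show ?thesis using 0 coeff_defect[of j] j by (metis diff_self lessI less_SucI mult_zero_left mult_zero_right add_0)
  next
    case 3
    then show ?thesis using 0 coeff_defect[of j] j by simp
  qed
qed

lemma degree_defect: "k \<ge> 2 \<Longrightarrow> degree defect \<le> 2 * k - 3"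
  using coeff_defect_eq_0 by (intro degree_le) auto

text \<open>Lagrange's identity for the self-adjoint form of the operator. With
  \<open>w = k^2 - t^2\<close>, \<open>R = defect\<close> and \<open>g = w (F' R - F R')\<close>,
  the expression in \<open>first_order_identity\<close> is \<open>w R^2\<close> plus a multiple of
  \<open>w F\<close>. As \<open>w F\<close> vanishes at every \<open>y \<bullet> z\<close>, the
  nonnegative terms \<open>w R^2\<close> sum to zero.\<close>

lemma defect_on_Y:
  assumes "k \<ge> 2" "z \<in> Y" "y \<in> Y" "y \<noteq> z"
  shows "poly defect (y \<bullet> z) = 0"
proof -
  let ?w = "\<lambda>t. (real k)\<^sup>2 - t\<^sup>2" and ?n = "real CARD('n)" and ?R = defect
  define \<mu> where "\<mu> = real (2 * k - 1) * (real (2 * k - 1) + ?n)"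
  define h where "h = pderiv F * ?R - F * pderiv ?R"
  define g where "g = [:(real k)\<^sup>2, 0, -1:] * h"
  have dF': "degree (pderiv F) = 2 * k - 2" by (simp add: degree_pderiv degree_F)
  have dR: "degree ?R \<le> 2 * k - 3" "degree (pderiv ?R) \<le> 2 * k - 4"
    using degree_defect[OF assms(1)] by (auto simp: degree_pderiv)
  have "degree (pderiv F * ?R) \<le> (2 * k - 2) + (2 * k - 3)"
    using degree_mult_le[of "pderiv F" ?R] dF' dR by linarith
  moreover have "degree (F * pderiv ?R) \<le> (2 * k - 2) + (2 * k - 3)"
    using degree_mult_le[of F "pderiv ?R"] degree_F dR assms(1) by linarith
  ultimately have "degree h \<le> (2 * k - 2) + (2 * k - 3)"
    unfolding h_def by (rule degree_diff_le)
  moreover have "degree [:(real k)\<^sup>2, 0, -1:] = 2" by simp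
  \<comment> \<open>\<open>2 + (2 * k - 2) + (2 * k - 3)\<close> is just the admissible degree; the
    degree drop of \<open>defect\<close> makes it fit.\<close>
  ultimately have deg: "degree g \<le> 2 * (2 * k - 1) - 1"
    using degree_mult_le[of "[:(real k)\<^sup>2, 0, -1:]" h] assms(1) unfolding g_def by linarith
  have odd: "odd_poly g"
    unfolding g_def h_def
    by (intro even_poly_mult_odd even_poly_quadratic odd_poly_diff odd_poly_mult_even odd_F
        even_poly_pderiv odd_defect)
  have R: "poly ?R t = ?w t * poly (pderiv (pderiv F)) t - (?n + 1) * t * poly (pderiv F) t + \<mu> * poly F t" for t
    unfolding defect_def poly_add poly_diff poly_mult poly_smult \<mu>_def by (simp add: power2_eq_square algebra_simps)
  have h': "poly (pderiv h) t = poly (pderiv (pderiv F)) t * poly ?R t - poly F t * poly (pderiv (pderiv ?R)) t" for t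
    unfolding h_def pderiv_diff pderiv_mult poly_diff poly_add poly_mult by (simp add: algebra_simps)
  have g: "poly g t = ?w t * poly h t" "poly (pderiv g) t = ?w t * poly (pderiv h) t - 2 * t * poly h t" for t
    unfolding g_def pderiv_mult poly_add poly_mult by (simp_all add: pderiv_pCons power2_eq_square algebra_simps)
  have key: "?w t * poly (pderiv g) t - (?n - 1) * t * poly g t =
      ?w t * (poly ?R t)\<^sup>2 - ?w t * poly F t * (\<mu> * poly ?R t + ?w t * poly (pderiv (pderiv ?R)) t
        - (?n + 1) * t * poly (pderiv ?R) t)" for t
  proof -
    define w a b d r r' r'' where defs: "w = ?w t" "a = poly F t" "b = poly (pderiv F) t"
      "d = poly (pderiv (pderiv F)) t" "r = poly ?R t" "r' = poly (pderiv ?R) t"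
      "r'' = poly (pderiv (pderiv ?R)) t"
    have "poly h t = b * r - a * r'" unfolding h_def defs by simp
    then have "?w t * poly (pderiv g) t - (?n - 1) * t * poly g t
        = w * (w * (d * r - a * r'') - (?n + 1) * t * (b * r - a * r'))"
      unfolding g h' by (simp only: defs[symmetric]) (simp add: algebra_simps)
    also have "\<dots> = w * (r * (w * d - (?n + 1) * t * b + \<mu> * a) - \<mu> * a * r - a * (w * r'' - (?n + 1) * t * r'))"
      by (simp add: algebra_simps)
    also have "w * d - (?n + 1) * t * b + \<mu> * a = r" using R[of t] defs by simp
    finally show ?thesis by (simp only: defs[symmetric]) (simp add: algebra_simps power2_eq_square)
  qed
  \<comment> \<open>For \<open>y \<noteq> z\<close> the factor \<open>F\<close> vanishes, for
    \<open>y = z\<close> the weight does.\<close>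
  have zero: "?w (y \<bullet> z) * poly F (y \<bullet> z) = 0" if "y \<in> Y" for y
    using that assms(2) poly_F_Y[of y z] by (auto simp: norm_Y)
  have "(\<Sum>y\<in>Y. ?w (y \<bullet> z) * (poly ?R (y \<bullet> z))\<^sup>2) = 0"
  proof -
    have "(\<Sum>y\<in>Y. ?w (y \<bullet> z) * (poly ?R (y \<bullet> z))\<^sup>2) =
      (\<Sum>y\<in>Y. ?w (y \<bullet> z) * poly (pderiv g) (y \<bullet> z) - (?n - 1) * (y \<bullet> z) * poly g (y \<bullet> z))"
      by (rule sum.cong) (simp_all only: key zero mult_zero_left diff_zero)
    then show ?thesis using first_order_identity[OF odd deg norm_Y[OF assms(2)]] by simp
  qed
  moreover have "?w (y \<bullet> z) * (poly ?R (y \<bullet> z))\<^sup>2 \<ge> 0" if "y \<in> Y" for y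
  proof -
    have "\<bar>y \<bullet> z\<bar> \<le> \<bar>real k\<bar>" using inner_bound[OF norm_Y[OF that] norm_Y[OF assms(2)]] by simp
    then have "(y \<bullet> z)\<^sup>2 \<le> (real k)\<^sup>2" by (simp only: abs_le_square_iff)
    then show ?thesis by simp
  qed
  ultimately have "?w (y \<bullet> z) * (poly ?R (y \<bullet> z))\<^sup>2 = 0"
    using assms(3) finite_Y by (simp add: sum_nonneg_eq_0_iff)
  moreover have "(y \<bullet> z)\<^sup>2 < (real k)\<^sup>2"
    using power_strict_mono[OF inner_less[OF assms(3,2,4)], of 2] by simp
  ultimately show ?thesis by simp
qed

text \<open>In the interpolation of \<open>defect\<close> along \<open>z\<close> only the node
  \<open>z\<close> survives, by \<open>defect_on_Y\<close>; so \<open>defect\<close> is a multiple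
  of \<open>F\<close>. Having smaller degree than \<open>F\<close>, it is zero.\<close>

lemma defect_eq_0:
  assumes "k \<ge> 2" "CARD('n) \<ge> 2"
  shows "defect = 0"
proof -
  have "card Y > 0" using assms by (simp add: card_Y)
  then obtain z where z: "z \<in> Y" by (metis card_gt_0_iff ex_in_conv)
  have eq: "c * poly defect t = poly defect (real k) * poly F t" if t: "\<bar>t\<bar> \<le> real k" for t
  proof -
    obtain x where x: "x \<bullet> x = real k" "x \<bullet> z = t"
      using exists_on_sphere_with_inner[of z "real k" t, OF _ norm_Y[OF z] _ t] assms k_pos by auto
    have "c * poly defect (x \<bullet> z) = (\<Sum>y\<in>Y. poly defect (y \<bullet> z) * poly F (y \<bullet> x))"
      using degree_defect[OF assms(1)] by (intro interpolation odd_defect x) auto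
    also have "\<dots> = (\<Sum>y\<in>Y. if y = z then poly defect (real k) * poly F (z \<bullet> x) else 0)"
      by (rule sum.cong) (use defect_on_Y[OF assms(1) z] norm_Y[OF z] in auto)
    also have "\<dots> = poly defect (real k) * poly F (z \<bullet> x)" using finite_Y z by simp
    finally show ?thesis using x(2) by (simp add: inner_commute)
  qed
  define q where "q = smult c defect - smult (poly defect (real k)) F"
  have "q = 0"
  proof (rule ccontr)
    assume "q \<noteq> 0"
    then have "finite {t. poly q t = 0}" by (rule poly_roots_finite)
    moreover have "{- real k..real k} \<subseteq> {t. poly q t = 0}" using eq by (auto simp: q_def)
    ultimately have "finite {- real k..real k}" by (rule finite_subset[rotated])
    then show False using k_pos infinite_Icc[of "- real k" "real k"] by simp
  qed
  moreover have "coeff q (2 * k - 1) = - poly defect (real k)"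
    using coeff_defect_eq_0[OF assms(1), of "2 * k - 1"] lead_F degree_F assms(1) by (simp add: q_def)
  ultimately have "poly defect (real k) = 0" by simp
  then show ?thesis using \<open>q = 0\<close> c_pos by (simp add: q_def)
qed

text \<open>At \<open>t = 1\<close>, a root of \<open>F\<close>, the differential equation relates
  only the first two derivatives of \<open>F\<close>, whose ratio is known from
  \<open>node_poly_derivs_at_1\<close>.\<close>

theorem dimension_and_norm:
  assumes "k \<ge> 2" "CARD('n) \<ge> 2"
  shows "k = 2 \<and> CARD('n) = 8"
proof -
  define a b where "a = poly (pderiv F) 1" and "b = poly (pderiv (pderiv F)) 1"
  have a: "b * (real k * (real k - 1)) = 2 * (2 * real k - 1) * a" "a \<noteq> 0"
    using node_poly_derivs_at_1[OF assms(1)] by (auto simp: a_def b_def)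
  have "poly F 1 = 0" using assms by (intro poly_node_poly_eq_0) auto
  moreover have "poly defect 1 = 0" using defect_eq_0[OF assms] by simp
  ultimately have b: "((real k)\<^sup>2 - 1) * b = (real CARD('n) + 1) * a"
    unfolding defect_def poly_add poly_diff poly_mult poly_smult a_def b_def
    by (simp add: algebra_simps)
  have "(real k - 1) * a * (2 * (real k + 1) * (2 * real k - 1)) = ((real k)\<^sup>2 - 1) * (b * (real k * (real k - 1)))"
    unfolding a(1) by (simp add: algebra_simps power2_eq_square)
  also have "\<dots> = (real k - 1) * a * (real k * (real CARD('n) + 1))"
    unfolding mult.assoc[symmetric] b by (simp only: mult_ac)
  finally have "2 * (real k + 1) * (2 * real k - 1) = real k * (real CARD('n) + 1)"
    using a(2) assms by simp
  \<comment> \<open>The equation is arranged without subtraction so that it transfers to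
    \<open>nat\<close>; modulo \<open>k\<close> only the constant 2 remains.\<close>
  then have "real (4 * k * k + 2 * k) = real (k * (CARD('n) + 1) + 2)" by (simp add: algebra_simps)
  then have e: "4 * k * k + 2 * k = k * (CARD('n) + 1) + 2" by (simp only: of_nat_eq_iff)
  have "k dvd 4 * k * k + 2 * k" by simp
  then have "k dvd 2" unfolding e by (simp only: dvd_add_right_iff dvd_triv_left)
  then have "k = 2" using assms(1) by (simp add: dvd_imp_le le_antisym)
  then show ?thesis using e by simp
qed

end

section \<open>Lattices, orthonormal frames and the easy cases\<close>

lemma int_span_add: "x \<in> int_span B \<Longrightarrow> y \<in> int_span B \<Longrightarrow> x + y \<in> int_span B"
proof -
  assume "x \<in> int_span B" "y \<in> int_span B"
  then obtain c d where "x = (\<Sum>b\<in>B. of_int (c b) *\<^sub>R b)" "y = (\<Sum>b\<in>B. of_int (d b) *\<^sub>R b)"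
    unfolding int_span_def by blast
  then have "x + y = (\<Sum>b\<in>B. of_int (c b + d b) *\<^sub>R b)"
    by (simp add: scaleR_add_left sum.distrib)
  then show ?thesis unfolding int_span_def by (intro CollectI exI[of _ "\<lambda>b. c b + d b"]) simp
qed

lemma int_span_scaleR: "x \<in> int_span B \<Longrightarrow> of_int m *\<^sub>R x \<in> int_span B"
proof -
  assume "x \<in> int_span B"
  then obtain c where "x = (\<Sum>b\<in>B. of_int (c b) *\<^sub>R b)"
    unfolding int_span_def by blast
  then have "of_int m *\<^sub>R x = (\<Sum>b\<in>B. of_int (m * c b) *\<^sub>R b)"
    by (simp add: scaleR_sum_right)
  then show ?thesis unfolding int_span_def by (intro CollectI exI[of _ "\<lambda>b. m * c b"]) simp
qed

context
  fixes L :: "'a::euclidean_space set"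
  assumes L: "is_lattice L"
begin

lemma lattice_add: "x \<in> L \<Longrightarrow> y \<in> L \<Longrightarrow> x + y \<in> L"
  using L int_span_add by (auto simp: is_lattice_def)

lemma lattice_scaleR: "x \<in> L \<Longrightarrow> r \<in> \<int> \<Longrightarrow> r *\<^sub>R x \<in> L"
  using L int_span_scaleR by (auto simp: is_lattice_def elim!: Ints_cases)

lemma lattice_minus: "x \<in> L \<Longrightarrow> - x \<in> L"
  using lattice_scaleR[of x "-1"] by simp

lemma lattice_diff: "x \<in> L \<Longrightarrow> y \<in> L \<Longrightarrow> x - y \<in> L"
  using lattice_add[of x "- y"] lattice_minus by simp

lemma lattice_zero: "0 \<in> L"
proof -
  obtain B where "L = int_span B" using L by (auto simp: is_lattice_def)
  then show ?thesis unfolding int_span_def by (auto intro!: exI[of _ "\<lambda>_. 0"])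
qed

lemma lattice_sum: "(\<And>i. i \<in> I \<Longrightarrow> f i \<in> L) \<Longrightarrow> (\<Sum>i\<in>I. f i) \<in> L"
  by (induction I rule: infinite_finite_induct) (auto intro: lattice_add lattice_zero)

end

text \<open>\<open>SOME\<close> chooses from \<open>{y, - y}\<close>, which is the same set for
  \<open>- y\<close>; so both vectors of a pair pick the same representative.\<close>

lemma antipodal_half:
  fixes X :: "'a::real_vector set"
  assumes "finite X" "0 \<notin> X" "\<And>x. x \<in> X \<Longrightarrow> - x \<in> X"
  obtains Y where "Y \<subseteq> X" "X = Y \<union> uminus ` Y" "Y \<inter> uminus ` Y = {}" "card X = 2 * card Y"
proof -
  define r where "r y = (SOME z. z \<in> {y, - y})" for y :: 'a
  have r: "r y \<in> {y, - y}" for y unfolding r_def by (rule someI[of _ y]) simp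
  have r_minus: "r (- y) = r y" for y
    unfolding r_def by (metis insert_commute minus_minus)
  define Y where "Y = {y \<in> X. r y = y}"
  have neq: "y \<noteq> - y" if "y \<in> X" for y
  proof
    assume "y = - y"
    then have "2 *\<^sub>R y = 0" by (metis add.right_inverse scaleR_2)
    then show False using that assms(2) by simp
  qed
  have 1: "Y \<subseteq> X" by (auto simp: Y_def)
  have "x \<in> Y \<union> uminus ` Y" if "x \<in> X" for x
  proof (cases "r x = x")
    case False
    then have "r (- x) = - x" using r[of x] r_minus[of x] by auto
    then have "- x \<in> Y" using that assms(3) by (simp add: Y_def)
    then show ?thesis by (metis UnI2 imageI minus_minus)
  qed (use that in \<open>simp add: Y_def\<close>)
  then have 2: "X = Y \<union> uminus ` Y" using 1 assms(3) by auto
  have 3: "Y \<inter> uminus ` Y = {}" using neq r_minus by (force simp: Y_def)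
  have "finite Y" using 1 assms(1) finite_subset by blast
  then have "card X = card Y + card (uminus ` Y)"
    by (subst 2, subst card_Un_disjoint) (use 3 in auto)
  also have "card (uminus ` Y) = card Y" by (intro card_image inj_onI) simp
  finally show ?thesis using that 1 2 3 by simp
qed

text \<open>Unit vectors that are neither equal nor opposite have inner product of absolute value
  below 1, and integrality makes it 0. One vector from each antipodal pair gives the frame.\<close>

lemma orthonormal_frame:
  fixes U :: "'a::euclidean_space set"
  assumes "finite U" "card U = 2 * CARD('i::finite)" "\<And>x. x \<in> U \<Longrightarrow> - x \<in> U"
    "\<And>x. x \<in> U \<Longrightarrow> x \<bullet> x = 1" "\<And>x y. x \<in> U \<Longrightarrow> y \<in> U \<Longrightarrow> x \<bullet> y \<in> \<int>"
  obtains p :: "'i::finite \<Rightarrow> 'a" where "\<And>i. p i \<in> U" "\<And>i j. p i \<bullet> p j = (if i = j then 1 else 0)"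
proof -
  have "0 \<notin> U" using assms(4) by fastforce
  then obtain Y where Y: "Y \<subseteq> U" "U = Y \<union> uminus ` Y" "Y \<inter> uminus ` Y = {}" "card U = 2 * card Y"
    using antipodal_half[of U] assms by blast
  have "finite Y" using Y assms finite_subset by blast
  moreover have "card (UNIV :: 'i set) = card Y" using Y assms by simp
  ultimately obtain p where p: "bij_betw p (UNIV :: 'i set) Y"
    using finite_same_card_bij by (metis finite_class.finite_UNIV)
  have pY: "p i \<in> Y" for i using p bij_betwE by blast
  have "p i \<bullet> p j = 0" if "i \<noteq> j" for i j
  proof -
    have "p i \<noteq> p j" using p that by (simp add: bij_betw_def inj_eq)
    moreover have "p i \<noteq> - p j" using Y(3) pY by blast
    ultimately have "(p i - p j) \<bullet> (p i - p j) > 0" "(p i + p j) \<bullet> (p i + p j) > 0"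
      by (auto simp: add_eq_0_iff)
    then have "\<bar>p i \<bullet> p j\<bar> < 1"
      using assms(4)[of "p i"] assms(4)[of "p j"] subsetD[OF Y(1) pY[of i]] subsetD[OF Y(1) pY[of j]]
      by (simp add: algebra_simps inner_commute)
    then show ?thesis using assms(5) pY Y(1) by (meson Ints_nonzero_abs_less1 subsetD)
  qed
  then show ?thesis using that[of p] pY Y(1) assms(4) by (metis subsetD)
qed

section \<open>Coordinates with respect to an orthonormal frame\<close>

definition frame_map :: "('i::finite \<Rightarrow> 'a::euclidean_space) \<Rightarrow> 'a \<Rightarrow> real ^ 'i" where
  "frame_map p x = (\<chi> i. x \<bullet> p i)"

lemma frame_map_nth [simp]: "frame_map p x $ i = x \<bullet> p i"
  by (simp add: frame_map_def)

lemma linear_frame_map: "linear (frame_map p)"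
  by (rule linearI) (auto simp: vec_eq_iff inner_add_left)

context
  fixes p :: "'i::finite \<Rightarrow> 'a::euclidean_space"
  assumes p: "\<And>i j. p i \<bullet> p j = (if i = j then 1 else 0)" and dim: "CARD('i) = DIM('a)"
begin

lemma frame_expansion: "x = (\<Sum>i\<in>UNIV. (x \<bullet> p i) *\<^sub>R p i)"
proof -
  have inj: "inj p"
  proof (rule injI)
    fix i j assume "p i = p j"
    then have "p i \<bullet> p j = 1" using p[of j j] by simp
    then show "i = j" using p[of i j] by (auto split: if_splits)
  qed
  have orth: "pairwise orthogonal (range p)"
    by (auto simp: pairwise_def orthogonal_def p)
  have one: "norm b = 1" if "b \<in> range p" for b using that p by (auto simp: norm_eq_sqrt_inner)
  have "independent (range p)"
    using orth one[of 0] by (intro pairwise_orthogonal_independent) auto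
  moreover have "card (range p) = DIM('a)" using inj dim by (simp add: card_image)
  ultimately have "span (range p) = UNIV"
    by (metis card_eq_dim dim_UNIV finite_imageI finite_class.finite_UNIV independent_card_le order_refl subset_UNIV top.extremum_uniqueI card_le_dim_spanning)
  then have "(\<Sum>b\<in>range p. (x \<bullet> b) *\<^sub>R b) = x"
    using orth one by (intro orthonormal_basis_expand) auto
  then show ?thesis by (simp add: sum.reindex[OF inj])
qed

lemma frame_map_inner: "frame_map p x \<bullet> frame_map p y = x \<bullet> y"
proof -
  have "x \<bullet> y = (\<Sum>i\<in>UNIV. (x \<bullet> p i) *\<^sub>R p i) \<bullet> y" using frame_expansion[of x] by simp
  then show ?thesis unfolding inner_sum_left by (simp add: inner_vec_def inner_commute)
qed

lemma frame_map_combination: "frame_map p (\<Sum>i\<in>UNIV. (z $ i) *\<^sub>R p i) = z"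
  by (simp add: vec_eq_iff inner_sum_left p if_distrib[of "\<lambda>t. _ * t"] cong: if_cong)

lemma isometric_frame_map: "frame_map p ` L = M \<Longrightarrow> isometric L M"
  unfolding isometric_def using linear_frame_map frame_map_inner by blast

end

lemma isometric_num_vectors:
  assumes "isometric L M"
  shows "num_vectors L k = num_vectors M k"
proof -
  obtain f where f: "linear f" "\<And>x y. f x \<bullet> f y = x \<bullet> y" "f ` L = M"
    using assms by (auto simp: isometric_def)
  have n: "norm (f x) = norm x" for x by (simp add: norm_eq_sqrt_inner f)
  have "inj f" using f(1) n by (simp add: linear_injective_0) (metis norm_eq_zero)
  then have "card (f ` {y \<in> L. (norm y)\<^sup>2 = real k}) = num_vectors L k"
    unfolding num_vectors_def by (intro card_image) (auto intro: inj_on_subset)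
  moreover have "f ` {y \<in> L. (norm y)\<^sup>2 = real k} = {y \<in> M. (norm y)\<^sup>2 = real k}"
    using f(3) n by auto
  ultimately show ?thesis by (simp add: num_vectors_def)
qed

text \<open>Half of the unit vectors form an orthonormal frame inside \<open>L\<close>. Coordinates
  are inner products of lattice vectors, hence integers, and all integral combinations of the frame
  lie in \<open>L\<close>.\<close>

lemma unit_vectors_imp_isometric_Z:
  fixes L :: "(real ^ 'n) set"
  assumes "integral_lattice L" "num_vectors L 1 = 2 * CARD('n)"
  shows "isometric L (Z_lattice :: (real ^ 'n) set)"
proof -
  define U where "U = {y \<in> L. (norm y)\<^sup>2 = 1}"
  have L: "is_lattice L" "\<And>x y. x \<in> L \<Longrightarrow> y \<in> L \<Longrightarrow> x \<bullet> y \<in> \<int>"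
    using assms(1) by (auto simp: integral_lattice_def)
  have U: "card U = 2 * CARD('n)" using assms(2) by (simp add: U_def num_vectors_def)
  then have "card U > 0" by simp
  then have "finite U" by (rule card_ge_0_finite)
  moreover have "- x \<in> U" "x \<bullet> x = 1" if "x \<in> U" for x
    using that lattice_minus[OF L(1)] by (auto simp: U_def power2_norm_eq_inner)
  moreover have "x \<bullet> y \<in> \<int>" if "x \<in> U" "y \<in> U" for x y
    using that L(2) by (auto simp: U_def)
  ultimately obtain p :: "'n \<Rightarrow> real ^ 'n" where p: "\<And>i. p i \<in> U" "\<And>i j. p i \<bullet> p j = (if i = j then 1 else 0)"
    using orthonormal_frame[of U] U by blast
  have pL: "p i \<in> L" for i using p(1) by (auto simp: U_def)
  have "frame_map p ` L = Z_lattice"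
  proof
    show "frame_map p ` L \<subseteq> Z_lattice" using L(2) pL by (auto simp: Z_lattice_def)
    show "Z_lattice \<subseteq> frame_map p ` L"
    proof
      fix z :: "real ^ 'n" assume "z \<in> Z_lattice"
      then have "(\<Sum>i\<in>UNIV. (z $ i) *\<^sub>R p i) \<in> L"
        by (intro lattice_sum[OF L(1)] lattice_scaleR[OF L(1)] pL) (auto simp: Z_lattice_def)
      then show "z \<in> frame_map p ` L"
        by (rule image_eqI[rotated]) (simp add: frame_map_combination[OF p(2)])
    qed
  qed
  then show ?thesis by (intro isometric_frame_map[OF p(2)]) simp_all
qed

text \<open>A nonzero integer coordinate contributes at least 1 to the squared norm, so a unit
  vector has exactly one.\<close>

lemma num_vectors_Z_lattice: "num_vectors (Z_lattice :: (real ^ 'n) set) 1 = 2 * CARD('n)"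
proof -
  have eq: "{y \<in> Z_lattice. (norm y)\<^sup>2 = real 1} =
      (\<lambda>i. axis i 1) ` UNIV \<union> (\<lambda>i. axis i (-1)) ` (UNIV :: 'n set)"
  proof (intro set_eqI iffI)
    fix y :: "real ^ 'n"
    assume "y \<in> {y \<in> Z_lattice. (norm y)\<^sup>2 = real 1}"
    then have Z: "\<And>i. y $ i \<in> \<int>" and n: "(\<Sum>i\<in>UNIV. (y $ i)\<^sup>2) = 1"
      by (auto simp: Z_lattice_def power2_norm_eq_inner inner_vec_def simp flip: power2_eq_square)
    then have "y \<noteq> 0" by auto
    then obtain i where i: "y $ i \<noteq> 0" by (auto simp: vec_eq_iff)
    have ge: "(y $ j)\<^sup>2 \<ge> 1" if "y $ j \<noteq> 0" for j
      using Ints_nonzero_abs_ge1[OF Z that] using abs_le_square_iff[of 1 "y $ j"] by simp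
    have rest: "y $ j = 0" if "j \<noteq> i" for j
    proof (rule ccontr)
      assume "y $ j \<noteq> 0"
      then have "2 \<le> (\<Sum>l\<in>{i, j}. (y $ l)\<^sup>2)" using ge[of i] ge[of j] i that by simp
      also have "\<dots> \<le> (\<Sum>l\<in>UNIV. (y $ l)\<^sup>2)" by (intro sum_mono2) auto
      finally show False using n by simp
    qed
    then have "(y $ i)\<^sup>2 = 1" using n sum.remove[of UNIV i "\<lambda>l. (y $ l)\<^sup>2"] by simp
    then have "y = axis i 1 \<or> y = axis i (-1)"
      using rest by (auto simp: vec_eq_iff axis_def power2_eq_1_iff)
    then show "y \<in> (\<lambda>i. axis i 1) ` UNIV \<union> (\<lambda>i. axis i (-1)) ` UNIV" by auto
  next
    fix y :: "real ^ 'n"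
    assume "y \<in> (\<lambda>i. axis i 1) ` UNIV \<union> (\<lambda>i. axis i (-1)) ` UNIV"
    then show "y \<in> {y \<in> Z_lattice. (norm y)\<^sup>2 = real 1}"
      by (auto simp: Z_lattice_def axis_def norm_eq_sqrt_inner inner_vec_def if_distrib cong: if_cong)
  qed
  have "inj (\<lambda>i::'n. axis i (1::real))" "inj (\<lambda>i::'n. axis i (-1::real))"
    by (auto simp: inj_def axis_eq_axis)
  moreover have "(\<lambda>i. axis i 1) ` UNIV \<inter> (\<lambda>i. axis i (-1)) ` (UNIV :: 'n set) = ({} :: (real ^ 'n) set)"
    by (auto simp: axis_eq_axis)
  ultimately show ?thesis unfolding num_vectors_def eq
    by (simp add: card_Un_disjoint card_image)
qed

section \<open>One-dimensional lattices\<close>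

lemma line_lattice_cases:
  fixes L :: "(real ^ 'n) set"
  assumes "integral_lattice L" "full_rank L" "CARD('n) = 1"
  obtains a where "a > 0" "a\<^sup>2 \<in> \<int>" "L = line_lattice a"
proof -
  obtain B where B: "independent B" "L = int_span B"
    using assms by (auto simp: integral_lattice_def is_lattice_def)
  have "L \<subseteq> span B" unfolding B int_span_def by (auto intro: span_sum span_scale span_base)
  then have "span B = UNIV" using assms(2) unfolding full_rank_def by (metis span_minimal subspace_span top.extremum_uniqueI)
  then have "card B = 1"
    using B(1) assms(3) by (metis DIM_cart DIM_real basis_card_eq_dim dim_UNIV mult.right_neutral subset_UNIV)
  then obtain v where v: "B = {v}" by (auto simp: card_Suc_eq numeral_eq_Suc card_1_singleton_iff)
  obtain i :: 'n where i: "UNIV = {i}" using assms(3) by (metis card_1_singletonE)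
  then have i': "j = i" for j by (metis UNIV_I singletonD)
  define a where "a = v $ i"
  have "v \<noteq> 0" using B(1) v by (auto simp: dependent_zero)
  then have "a \<noteq> 0" using i' by (metis a_def vec_eq_iff zero_index)
  have L: "L = range (\<lambda>m::int. vec (a * of_int m))"
  proof -
    have "of_int m *\<^sub>R v = vec (a * of_int m)" for m :: int
      using i' by (simp add: vec_eq_iff a_def) (metis mult.commute)
    then show ?thesis unfolding B v int_span_def by (auto simp: image_iff)
  qed
  \<comment> \<open>A negative generator is replaced by its opposite, with \<open>m\<close> replaced
    by \<open>- m\<close>.\<close>
  have "L = line_lattice \<bar>a\<bar>"
  proof (cases "a > 0")
    case False
    then have "\<bar>a\<bar> * of_int m = a * of_int (- m)" for m by simp
    then show ?thesis unfolding L line_lattice_def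
      by (auto simp: image_iff) (metis minus_minus of_int_minus mult_minus_right)+
  qed (simp add: L line_lattice_def)
  moreover have "v \<in> L" using L i' by (auto simp: image_iff vec_eq_iff a_def intro!: exI[of _ 1]) (metis)
  then have "v \<bullet> v \<in> \<int>" using assms by (auto simp: integral_lattice_def)
  then have "\<bar>a\<bar>\<^sup>2 \<in> \<int>" by (simp add: inner_vec_def i a_def power2_eq_square)
  ultimately show ?thesis using that[of "\<bar>a\<bar>"] \<open>a \<noteq> 0\<close> by simp
qed

lemma norm_vec_line:
  assumes "CARD('n) = 1"
  shows "(norm (vec t :: real ^ 'n))\<^sup>2 = t\<^sup>2"
  using assms unfolding power2_norm_eq_inner inner_vec_def by (simp add: power2_eq_square)

lemma represents_line_lattice:
  assumes "CARD('n) = 1"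
  shows "represents (line_lattice a :: (real ^ 'n) set) k \<longleftrightarrow> (\<exists>m::int. a\<^sup>2 * (of_int m)\<^sup>2 = real k)"
  by (simp add: represents_def line_lattice_def norm_vec_line[OF assms] power_mult_distrib)

lemma num_vectors_line_lattice:
  assumes "CARD('n) = 1" "a > 0" "k \<ge> 1"
  shows "num_vectors (line_lattice a :: (real ^ 'n) set) k = 2 \<longleftrightarrow> (\<exists>m::int. a\<^sup>2 * (of_int m)\<^sup>2 = real k)"
proof
  assume "num_vectors (line_lattice a :: (real ^ 'n) set) k = 2"
  then have "{y \<in> line_lattice a :: (real ^ 'n) set. (norm y)\<^sup>2 = real k} \<noteq> {}"
    unfolding num_vectors_def by force
  then show "\<exists>m::int. a\<^sup>2 * (of_int m)\<^sup>2 = real k"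
    using represents_line_lattice[OF assms(1)] by (auto simp: represents_def)
next
  assume "\<exists>m::int. a\<^sup>2 * (of_int m)\<^sup>2 = real k"
  then obtain m :: int where m: "a\<^sup>2 * (of_int m)\<^sup>2 = real k" by blast
  have "a\<^sup>2 * (of_int l)\<^sup>2 = real k \<longleftrightarrow> l = m \<or> l = - m" for l :: int
  proof -
    have "a\<^sup>2 * (of_int l)\<^sup>2 = real k \<longleftrightarrow> (of_int l)\<^sup>2 = (of_int m :: real)\<^sup>2"
      using m assms(2) by (metis less_irrefl mult_left_cancel zero_eq_power2)
    then show ?thesis by (simp add: power2_eq_iff) (metis of_int_eq_iff of_int_minus)
  qed
  then have eq: "{y \<in> line_lattice a :: (real ^ 'n) set. (norm y)\<^sup>2 = real k} = {vec (a * of_int m), vec (a * of_int (- m))}"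
    by (auto simp: line_lattice_def norm_vec_line[OF assms(1)] power_mult_distrib simp del: mult_minus_right of_int_minus)
  \<comment> \<open>\<open>k \<ge> 1\<close> excludes \<open>m = 0\<close>, so \<open>m\<close> and
    \<open>- m\<close> give different vectors.\<close>
  have "m \<noteq> 0" using m assms(3) by auto
  then have "vec (a * of_int m) \<noteq> (vec (a * of_int (- m)) :: real ^ 'n)"
    using assms(2) by (simp add: vec_eq_iff)
  then show "num_vectors (line_lattice a :: (real ^ 'n) set) k = 2"
    unfolding num_vectors_def eq by simp
qed

section \<open>Recognising the \<open>E\<^sub>8\<close> lattice\<close>

lemma half_integer:
  fixes t :: real
  assumes "2 * t \<in> \<int>" "t \<notin> \<int>"
  shows "t - 1 / 2 \<in> \<int>"
proof -
  obtain l :: int where l: "2 * t = of_int l" using assms(1) by (auto elim: Ints_cases)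
  show ?thesis
  proof (cases "even l")
    case True
    then obtain j where "l = 2 * j" by blast
    then have "t = of_int j" using l by simp
    then show ?thesis using assms(2) by simp
  next
    case False
    then obtain j where "l = 2 * j + 1" by (rule oddE)
    then have "t - 1 / 2 = of_int j" using l by simp
    then show ?thesis by simp
  qed
qed

text \<open>Integrality against the \<open>D8\<close> vectors forces coordinates that are all
  integral or all half-odd, and integrality against \<open>v\<close> then forces an even coordinate
  sum. Conversely \<open>L\<close> contains the \<open>D8\<close> lattice and its translate by
  \<open>v\<close>, which together make up \<open>E8_lattice\<close>.\<close>

lemma isometric_E8_if_even_frame:
  fixes L :: "(real ^ 'n) set" and q :: "8 \<Rightarrow> real ^ 'n"
  assumes "integral_lattice L" "CARD('n) = 8"
    and q: "\<And>i j. q i \<bullet> q j = (if i = j then 1 else 0)"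
    and D8: "\<And>i j. q i + q j \<in> L" "\<And>i j. q i - q j \<in> L"
    and v: "v \<in> L" "\<And>i. v \<bullet> q i - 1 / 2 \<in> \<int>" "(\<Sum>i\<in>UNIV. v \<bullet> q i) = 2 * of_int m"
  shows "isometric L E8_lattice"
proof -
  have lat: "is_lattice L" and int: "\<And>x y. x \<in> L \<Longrightarrow> y \<in> L \<Longrightarrow> x \<bullet> y \<in> \<int>"
    using assms(1) by (auto simp: integral_lattice_def)
  note add = lattice_add[OF lat] and diff = lattice_diff[OF lat] and scale = lattice_scaleR[OF lat]
    and sum = lattice_sum[OF lat]
  note comb = frame_map_combination[OF q] and inner = frame_map_inner[OF q]
  let ?f = "frame_map q"
  \<comment> \<open>The coordinates of \<open>v\<close> are integers plus 1/2, so modulo the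
    integers \<open>x \<bullet> v\<close> is half the coordinate sum of \<open>x\<close>.\<close>
  have even_sum: "\<exists>l::int. (\<Sum>i\<in>UNIV. x \<bullet> q i) = 2 * of_int l"
    if x: "x \<in> L" "\<And>i. x \<bullet> q i \<in> \<int>" for x
  proof -
    have "x \<bullet> v = (\<Sum>i\<in>UNIV. (x \<bullet> q i) * (v \<bullet> q i))"
      using inner[of x v] assms(2) by (simp add: inner_vec_def)
    also have "\<dots> = (\<Sum>i\<in>UNIV. (x \<bullet> q i) * (v \<bullet> q i - 1 / 2)) + (\<Sum>i\<in>UNIV. x \<bullet> q i) / 2"
      by (simp add: algebra_simps sum_subtractf sum_divide_distrib)
    finally have "(\<Sum>i\<in>UNIV. x \<bullet> q i) / 2 = x \<bullet> v - (\<Sum>i\<in>UNIV. (x \<bullet> q i) * (v \<bullet> q i - 1 / 2))"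
      by simp
    also have "\<dots> \<in> \<int>" by (intro Ints_diff int x v Ints_sum Ints_mult)
    finally obtain l where "(\<Sum>i\<in>UNIV. x \<bullet> q i) / 2 = of_int l" by (rule Ints_cases)
    then show ?thesis by (intro exI[of _ l]) simp
  qed
  have D8_mem: "(\<Sum>i\<in>UNIV. (z $ i) *\<^sub>R q i) \<in> L"
    if z: "\<And>i. z $ i \<in> \<int>" "(\<Sum>i\<in>UNIV. z $ i) = 2 * of_int l" for z :: "real ^ 8" and l :: int
  proof -
    \<comment> \<open>The coordinates are collected on \<open>q 0\<close>, where their even sum
      gives a multiple of \<open>q 0 + q 0\<close>.\<close>
    have "(\<Sum>i\<in>UNIV. (z $ i) *\<^sub>R q i) = (\<Sum>i\<in>UNIV. (z $ i) *\<^sub>R (q i - q 0)) + (\<Sum>i\<in>UNIV. z $ i) *\<^sub>R q 0"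
      by (simp add: scaleR_diff_right sum_subtractf scaleR_sum_left)
    also have "(\<Sum>i\<in>UNIV. z $ i) *\<^sub>R q 0 = of_int l *\<^sub>R (q 0 + q 0)"
      unfolding z(2) by (simp only: scaleR_add_right scaleR_add_left[symmetric] mult_2)
    finally show ?thesis by (simp only:) (intro add sum scale D8 z(1) Ints_of_int)
  qed
  have "?f ` L = E8_lattice"
  proof
    show "?f ` L \<subseteq> E8_lattice"
    proof
      fix z assume "z \<in> ?f ` L"
      then obtain x where x: "x \<in> L" "z = ?f x" by blast
      show "z \<in> E8_lattice"
      proof (cases "\<forall>i. x \<bullet> q i \<in> \<int>")
        case True
        then show ?thesis using even_sum[of x] x by (auto simp: E8_lattice_def)
      next
        case False
        then obtain j where j: "x \<bullet> q j \<notin> \<int>" by blast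
        have nonint: "x \<bullet> q i \<notin> \<int>" for i
        proof
          assume "x \<bullet> q i \<in> \<int>"
          moreover have "x \<bullet> (q j - q i) \<in> \<int>" by (intro int x D8)
          ultimately have "x \<bullet> (q j - q i) + x \<bullet> q i \<in> \<int>" by (intro Ints_add)
          then show False using j by (simp add: inner_diff_right)
        qed
        have half: "x \<bullet> q i - 1 / 2 \<in> \<int>" for i
        proof (rule half_integer[OF _ nonint])
          have "x \<bullet> (q i + q i) \<in> \<int>" by (intro int x D8)
          then show "2 * (x \<bullet> q i) \<in> \<int>" by (simp only: inner_add_right mult_2)
        qed
        \<comment> \<open>Subtracting \<open>v\<close> returns to integral coordinates, where
          \<open>even_sum\<close> applies.\<close>
        have "(x - v) \<bullet> q i \<in> \<int>" for i
          using Ints_diff[OF half[of i] v(2)[of i]] by (simp add: inner_diff_left)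
        then obtain l :: int where "(\<Sum>i\<in>UNIV. (x - v) \<bullet> q i) = 2 * of_int l"
          using even_sum[of "x - v"] diff x(1) v(1) by blast
        then have "(\<Sum>i\<in>UNIV. x \<bullet> q i) = 2 * of_int (l + m)"
          using v(3) by (simp add: inner_diff_left sum_subtractf)
        then have "\<exists>l::int. (\<Sum>i\<in>UNIV. x \<bullet> q i) = 2 * of_int l" by blast
        then show ?thesis using half x unfolding E8_lattice_def by auto
      qed
    qed
    show "E8_lattice \<subseteq> ?f ` L"
    proof
      fix z assume "z \<in> E8_lattice"
      then obtain l :: int where z: "(\<forall>i. z $ i \<in> \<int>) \<or> (\<forall>i. z $ i - 1 / 2 \<in> \<int>)"
          "(\<Sum>i\<in>UNIV. z $ i) = 2 * of_int l"
        by (auto simp: E8_lattice_def)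
      from z(1) show "z \<in> ?f ` L"
      proof
        assume "\<forall>i. z $ i \<in> \<int>"
        then have "(\<Sum>i\<in>UNIV. (z $ i) *\<^sub>R q i) \<in> L" using D8_mem z(2) by blast
        then show ?thesis by (rule image_eqI[rotated]) (simp add: comb assms(2))
      next
        assume half: "\<forall>i. z $ i - 1 / 2 \<in> \<int>"
        define z' where "z' = z - ?f v"
        have "z' $ i \<in> \<int>" for i
          using Ints_diff[of "z $ i - 1 / 2" "v \<bullet> q i - 1 / 2"] half v(2) by (simp add: z'_def)
        moreover have "(\<Sum>i\<in>UNIV. z' $ i) = 2 * of_int (l - m)"
          using z(2) v(3) by (simp add: z'_def sum_subtractf)
        ultimately have "(\<Sum>i\<in>UNIV. (z' $ i) *\<^sub>R q i) + v \<in> L"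
          using D8_mem add v(1) by blast
        then show ?thesis
          by (rule image_eqI[rotated])
             (simp add: linear_add[OF linear_frame_map] comb assms(2), simp add: z'_def)
      qed
    qed
  qed
  then show ?thesis by (intro isometric_frame_map[OF q]) (simp_all add: assms(2))
qed

text \<open>If the coordinates of the half-integral vector have odd sum, negating one frame vector makes
  the sum even.\<close>

lemma isometric_E8_if_frame:
  fixes L :: "(real ^ 'n) set" and p :: "8 \<Rightarrow> real ^ 'n"
  assumes "integral_lattice L" "CARD('n) = 8"
    and p: "\<And>i j. p i \<bullet> p j = (if i = j then 1 else 0)"
    and D8: "\<And>i j. p i + p j \<in> L" "\<And>i j. p i - p j \<in> L"
    and v: "v \<in> L" "v \<bullet> p 0 \<notin> \<int>"
  shows "isometric L E8_lattice"
proof -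
  have lat: "is_lattice L" and int: "\<And>x y. x \<in> L \<Longrightarrow> y \<in> L \<Longrightarrow> x \<bullet> y \<in> \<int>"
    using assms(1) by (auto simp: integral_lattice_def)
  have nonint: "v \<bullet> p i \<notin> \<int>" for i
  proof
    assume "v \<bullet> p i \<in> \<int>"
    moreover have "v \<bullet> (p 0 - p i) \<in> \<int>" by (intro int v D8)
    ultimately have "v \<bullet> (p 0 - p i) + v \<bullet> p i \<in> \<int>" by (intro Ints_add)
    then show False using v(2) by (simp add: inner_diff_right)
  qed
  have half: "v \<bullet> p i - 1 / 2 \<in> \<int>" for i
  proof (rule half_integer[OF _ nonint])
    have "v \<bullet> (p i + p i) \<in> \<int>" by (intro int v D8)
    then show "2 * (v \<bullet> p i) \<in> \<int>" by (simp only: inner_add_right mult_2)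
  qed
  have "(\<Sum>i\<in>UNIV. v \<bullet> p i) = (\<Sum>i\<in>UNIV. v \<bullet> p i - 1 / 2) + 4"
    by (simp add: sum_subtractf)
  also have "\<dots> \<in> \<int>" by (intro Ints_add Ints_sum half) simp
  finally obtain N where N: "(\<Sum>i\<in>UNIV. v \<bullet> p i) = of_int N" by (rule Ints_cases)
  obtain h where h: "v \<bullet> p 0 - 1 / 2 = of_int h" using half by (rule Ints_cases)
  show ?thesis
  proof (cases "even N")
    case True
    then obtain l where "N = 2 * l" by blast
    then have "(\<Sum>i\<in>UNIV. v \<bullet> p i) = 2 * of_int l" using N by simp
    then show ?thesis by (intro isometric_E8_if_even_frame[OF assms(1,2) p D8 v(1) half])
  next
    case False
    then obtain l where l: "N = 2 * l + 1" by (rule oddE)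
    \<comment> \<open>Flipping the sign of \<open>p 0\<close> lowers the sum by
      \<open>2 * (v \<bullet> p 0) = 2 * h + 1\<close>, an odd number.\<close>
    define q where "q i = (if i = 0 then - p 0 else p i)" for i
    have q: "q i \<bullet> q j = (if i = j then 1 else 0)" for i j by (auto simp: q_def p)
    have D8': "q i + q j \<in> L" "q i - q j \<in> L" for i j
      using D8[of i j] D8[of j i] lattice_minus[OF lat D8(1)[of 0 0]] lattice_zero[OF lat]
        lattice_minus[OF lat D8(1)[of 0 j]] lattice_minus[OF lat D8(1)[of i 0]]
      by (auto simp: q_def algebra_simps)
    have "v \<bullet> q i - 1 / 2 \<in> \<int>" for i
    proof (cases "i = 0")
      case True
      have "v \<bullet> q 0 - 1 / 2 = of_int (- h - 1)" using h by (simp add: q_def)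
      then show ?thesis using True by (simp only:) (rule Ints_of_int)
    qed (use half in \<open>simp add: q_def\<close>)
    moreover have "(\<Sum>i\<in>UNIV. v \<bullet> q i) = 2 * of_int (l - h)"
    proof -
      have "(\<Sum>i\<in>UNIV. v \<bullet> q i) = v \<bullet> q 0 + (\<Sum>i\<in>UNIV - {0}. v \<bullet> q i)" by (rule sum.remove) auto
      also have "(\<Sum>i\<in>UNIV - {0}. v \<bullet> q i) = (\<Sum>i\<in>UNIV - {0}. v \<bullet> p i)"
        by (rule sum.cong) (auto simp: q_def)
      also have "\<dots> = of_int N - v \<bullet> p 0" using N sum.remove[of UNIV 0 "\<lambda>i. v \<bullet> p i"] by simp
      finally show ?thesis using h by (simp add: l q_def)
    qed
    ultimately show ?thesis by (intro isometric_E8_if_even_frame[OF assms(1,2) q D8' v(1)])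
  qed
qed

section \<open>A frame from the moments of 240 roots\<close>

lemma Ints_square_le_power4: "t \<in> \<int> \<Longrightarrow> t\<^sup>2 \<le> t ^ 4" for t :: real
proof -
  assume "t \<in> \<int>"
  then obtain l :: int where "t = of_int l" by (rule Ints_cases)
  moreover have "l\<^sup>2 \<le> l ^ 4"
  proof (cases "l = 0")
    case False
    then have "1 \<le> l\<^sup>2" by (simp add: int_one_le_iff_zero_less)
    then have "l\<^sup>2 * 1 \<le> l\<^sup>2 * l\<^sup>2" by (intro mult_left_mono) auto
    then show ?thesis by (simp flip: power_add)
  qed simp
  ultimately show ?thesis by (metis of_int_le_iff of_int_power)
qed

text \<open>The constants are the moments of a spherical design of 240 vectors of squared norm 2 in
  dimension 8: \<open>240 * 2 / 8\<close> and \<open>3 * 240 * 2^2 / (8 * 10)\<close>.\<close>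

locale roots_240 =
  fixes L :: "(real ^ 'n) set" and X
  assumes integral: "integral_lattice L" and dim8: "CARD('n) = 8"
    and X_def: "X = {x \<in> L. x \<bullet> x = 2}" and card_X: "card X = 240"
    and M2: "(\<Sum>x\<in>X. (x \<bullet> u)\<^sup>2) = 60 * (u \<bullet> u)"
    and M4: "(\<Sum>x\<in>X. (x \<bullet> u) ^ 4) = 36 * (u \<bullet> u)\<^sup>2"
begin

lemma lat: "is_lattice L" using integral by (simp add: integral_lattice_def)

lemma int: "x \<in> L \<Longrightarrow> y \<in> L \<Longrightarrow> x \<bullet> y \<in> \<int>" using integral by (simp add: integral_lattice_def)

lemma finite_X: "finite X" using card_X by (intro card_ge_0_finite) simp

lemma XD: "x \<in> X \<Longrightarrow> x \<in> L" "x \<in> X \<Longrightarrow> x \<bullet> x = 2" by (auto simp: X_def)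

lemma X_minus: "x \<in> X \<Longrightarrow> - x \<in> X" using lattice_minus[OF lat] by (auto simp: X_def)

text \<open>Without a root orthogonal to \<open>a\<close>, all 240 inner products with
  \<open>a\<close> would be nonzero integers with squares summing to at least 240, whereas
  \<open>M2\<close> gives 120.\<close>

lemma orthogonal_roots: obtains a b where "a \<in> X" "b \<in> X" "a \<bullet> b = 0"
proof -
  obtain a where a: "a \<in> X" using card_X by fastforce
  show ?thesis
  proof (cases "\<exists>b\<in>X. a \<bullet> b = 0")
    case False
    have "real (card X) = (\<Sum>x\<in>X. 1)" by simp
    also have "\<dots> \<le> (\<Sum>x\<in>X. (x \<bullet> a)\<^sup>2)"
    proof (rule sum_mono)
      fix x assume x: "x \<in> X"
      then have "x \<bullet> a \<noteq> 0" "x \<bullet> a \<in> \<int>" using False a by (auto simp: inner_commute intro: int XD)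
      then have "\<bar>x \<bullet> a\<bar> \<ge> 1" by (simp add: Ints_nonzero_abs_ge1)
      then show "1 \<le> (x \<bullet> a)\<^sup>2" using abs_le_square_iff[of 1 "x \<bullet> a"] by simp
    qed
    also have "\<dots> = 120" using M2[of a] XD(2)[OF a] by simp
    finally show ?thesis using card_X by simp
  qed (use a that in blast)
qed

lemma root_inner_cases:
  assumes "x \<in> X" "a \<in> X"
  shows "x = a \<or> x = - a \<or> x \<bullet> a \<in> {-1, 0, 1}"
proof -
  obtain l :: int where l: "x \<bullet> a = of_int l" using int XD assms by (metis Ints_cases)
  show ?thesis
  proof (cases "x = a \<or> x = - a")
    case False
    then have "(x - a) \<bullet> (x - a) > 0" "(x + a) \<bullet> (x + a) > 0" by (auto simp: add_eq_0_iff)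
    then have "\<bar>x \<bullet> a\<bar> < 2"
      using XD(2)[OF assms(1)] XD(2)[OF assms(2)] by (simp add: algebra_simps inner_commute)
    then have "\<bar>l\<bar> < 2" using l by linarith
    then have "l \<in> {-1, 0, 1}" by auto
    then show ?thesis using l by auto
  qed auto
qed

context
  fixes a b
  assumes a: "a \<in> X" and b: "b \<in> X" and ab: "a \<bullet> b = 0"
begin

text \<open>In the standard model of \<open>E8\<close>, with \<open>a = (1, 1, 0, ..., 0)\<close>
  and \<open>b = (1, -1, 0, ..., 0)\<close>, these are the roots whose nonzero entries are 1 in the
  first place and 1 or -1 in one of the last six.\<close>

definition "Z = {x \<in> X. x \<bullet> a = 1 \<and> x \<bullet> b = 1}"

lemma aabb: "a \<bullet> a = 2" "b \<bullet> b = 2" "b \<bullet> a = 0"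
  using a b ab XD by (auto simp: inner_commute)

text \<open>Polarising \<open>M4\<close> and \<open>M2\<close> gives the sums of
  \<open>s^2 t^2\<close> and \<open>s t\<close>, where \<open>s\<close> and \<open>t\<close> are the
  inner products with \<open>a\<close> and \<open>b\<close>. The value \<open>s^2 t^2 + s t\<close>
  is 2 if \<open>s = t = 1\<close> or \<open>s = t = -1\<close> and 0 for all other roots, so the
  total counts \<open>Z\<close> and its negative.\<close>

lemma card_Z: "card Z = 12"
proof -
  let ?s = "\<lambda>x. x \<bullet> a" and ?t = "\<lambda>x. x \<bullet> b"
  have "(\<Sum>x\<in>X. (?s x + ?t x) ^ 4 + (?s x - ?t x) ^ 4) =
      (\<Sum>x\<in>X. (x \<bullet> (a + b)) ^ 4) + (\<Sum>x\<in>X. (x \<bullet> (a - b)) ^ 4)"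
    by (simp add: sum.distrib inner_add_right inner_diff_right)
  also have "\<dots> = 1152"
    unfolding M4 using aabb ab by (simp add: inner_add_left inner_add_right inner_diff_left inner_diff_right)
  also have "(\<Sum>x\<in>X. (?s x + ?t x) ^ 4 + (?s x - ?t x) ^ 4) =
      (\<Sum>x\<in>X. 2 * ?s x ^ 4 + 12 * ((?s x)\<^sup>2 * (?t x)\<^sup>2) + 2 * ?t x ^ 4)"
    by (rule sum.cong) (auto simp: power4_eq_xxxx power2_eq_square algebra_simps)
  also have "\<dots> = 2 * (\<Sum>x\<in>X. ?s x ^ 4) + 12 * (\<Sum>x\<in>X. (?s x)\<^sup>2 * (?t x)\<^sup>2) + 2 * (\<Sum>x\<in>X. ?t x ^ 4)"
    by (simp add: sum.distrib sum_distrib_left)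
  finally have Q: "(\<Sum>x\<in>X. (?s x)\<^sup>2 * (?t x)\<^sup>2) = 48" unfolding M4 using aabb by simp
  have "(\<Sum>x\<in>X. (x \<bullet> (a + b))\<^sup>2) = (\<Sum>x\<in>X. (?s x)\<^sup>2 + 2 * (?s x * ?t x) + (?t x)\<^sup>2)"
    by (rule sum.cong) (auto simp: inner_add_right power2_eq_square algebra_simps)
  also have "\<dots> = (\<Sum>x\<in>X. (?s x)\<^sup>2) + 2 * (\<Sum>x\<in>X. ?s x * ?t x) + (\<Sum>x\<in>X. (?t x)\<^sup>2)"
    by (simp add: sum.distrib sum_distrib_left)
  finally have P: "(\<Sum>x\<in>X. ?s x * ?t x) = 0"
    unfolding M2 using aabb ab by (simp add: inner_add_left inner_add_right)
  have "(?s x)\<^sup>2 * (?t x)\<^sup>2 + ?s x * ?t x = (if x \<in> Z \<union> uminus ` Z then 2 else 0)" if x: "x \<in> X" for x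
  proof -
    have mX: "- x \<in> X" using x by (rule X_minus)
    have Z: "x \<in> Z \<union> uminus ` Z \<longleftrightarrow> (?s x = 1 \<and> ?t x = 1) \<or> (?s x = -1 \<and> ?t x = -1)"
    proof -
      have "x \<in> uminus ` Z \<longleftrightarrow> - x \<in> Z" by (metis (no_types, lifting) image_iff minus_minus)
      then show ?thesis using x mX by (auto simp: Z_def)
    qed
    show ?thesis using root_inner_cases[OF x a] root_inner_cases[OF x b] aabb ab unfolding Z by auto
  qed
  then have "(\<Sum>x\<in>X. (?s x)\<^sup>2 * (?t x)\<^sup>2 + ?s x * ?t x) = (\<Sum>x\<in>X. if x \<in> Z \<union> uminus ` Z then 2 else 0)"
    by (rule sum.cong[OF refl])
  also have "\<dots> = 2 * real (card (X \<inter> (Z \<union> uminus ` Z)))"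
    using finite_X by (simp add: sum.If_cases Un_def)
  also have "X \<inter> (Z \<union> uminus ` Z) = Z \<union> uminus ` Z"
    using X_minus by (auto simp: Z_def)
  also have "card (Z \<union> uminus ` Z) = card Z + card (uminus ` Z)"
    using finite_X by (intro card_Un_disjoint) (auto simp: Z_def)
  also have "card (uminus ` Z) = card Z" by (intro card_image inj_onI) simp
  finally show ?thesis using P Q by (simp add: sum.distrib)
qed

definition "e1 = (1 / 2) *\<^sub>R (a + b)"
definition "e2 = (1 / 2) *\<^sub>R (a - b)"
text \<open>The frame with both signs: subtracting \<open>e1\<close> removes from \<open>z\<close>
  its component in the plane of \<open>a\<close> and \<open>b\<close>, and \<open>e1\<close>,
  \<open>e2\<close> span that plane.\<close>

definition "W = (\<lambda>z. z - e1) ` Z \<union> {e1, - e1, e2, - e2}"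

lemma e_inner: "e1 \<bullet> e1 = 1" "e2 \<bullet> e2 = 1" "e1 \<bullet> e2 = 0" "e2 \<bullet> e1 = 0"
  using aabb ab by (auto simp: e1_def e2_def inner_add_left inner_add_right inner_diff_left inner_diff_right)

lemma Z_inner:
  assumes "z \<in> Z"
  shows "z \<bullet> e1 = 1" "z \<bullet> e2 = 0" "e1 \<bullet> z = 1" "e2 \<bullet> z = 0" "z \<bullet> z = 2" "z \<in> L"
  using assms XD by (auto simp: Z_def e1_def e2_def inner_add_left inner_add_right inner_diff_left inner_diff_right inner_commute)

lemma card_W: "card W = 16" and finite_W: "finite W"
proof -
  have fZ: "finite Z" using finite_X by (simp add: Z_def)
  then show "finite W" by (simp add: W_def)
  have 4: "card {e1, - e1, e2, - e2} = 4"
  proof -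
    have "e1 \<noteq> - e1" "e1 \<noteq> e2" "e1 \<noteq> - e2" "- e1 \<noteq> e2" "- e1 \<noteq> - e2" "e2 \<noteq> - e2"
      using e_inner by (metis inner_minus_left inner_minus_right neg_equal_iff_equal neg_equal_zero one_neq_zero one_neq_neg_one)+
    then show ?thesis by simp
  qed
  have "(\<lambda>z. z - e1) ` Z \<inter> {e1, - e1, e2, - e2} = {}"
  proof -
    \<comment> \<open>\<open>z - e1\<close> is orthogonal to \<open>e1\<close> and
      \<open>e2\<close>, so it cannot equal any of the four unit vectors.\<close>
    have "z - e1 \<noteq> e" if "z \<in> Z" "e \<in> {e1, - e1, e2, - e2}" for z e
    proof
      assume *: "z - e1 = e"
      have "(z - e1) \<bullet> e = 0" using that Z_inner[OF that(1)] e_inner by (auto simp: inner_diff_left)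
      moreover have "e \<bullet> e = 1" using that e_inner by auto
      ultimately show False using * by simp
    qed
    then show ?thesis by blast
  qed
  then have "card W = card ((\<lambda>z. z - e1) ` Z) + card {e1, - e1, e2, - e2}"
    unfolding W_def using fZ by (intro card_Un_disjoint) auto
  moreover have "card ((\<lambda>z. z - e1) ` Z) = 12" using card_Z by (subst card_image) (auto intro: inj_onI)
  ultimately show "card W = 16" using 4 by simp
qed

lemma W_cases:
  assumes "w \<in> W"
  obtains z where "z \<in> Z" "w = z - e1" | "w = e1" | "w = - e1" | "w = e2" | "w = - e2"
  using assms by (auto simp: W_def)

text \<open>As \<open>a + b\<close> is \<open>2 *\<^sub>R e1\<close>, negating \<open>z - e1\<close>
  amounts to replacing \<open>z\<close> by \<open>a + b - z\<close>, which preserves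
  \<open>Z\<close>.\<close>

lemma W_minus: "w \<in> W \<Longrightarrow> - w \<in> W"
proof (erule W_cases)
  fix z assume z: "z \<in> Z" "w = z - e1"
  have ab2: "a + b = 2 *\<^sub>R e1" by (simp add: e1_def)
  have "a + b - z \<in> L" using z(1) XD a b by (intro lattice_diff[OF lat] lattice_add[OF lat]) (auto simp: Z_def)
  moreover have "(a + b - z) \<bullet> (a + b - z) = 2"
    unfolding ab2 using Z_inner[OF z(1)] e_inner by (simp add: inner_diff_left inner_diff_right)
  moreover have "(a + b - z) \<bullet> a = 1" "(a + b - z) \<bullet> b = 1"
    using z(1) aabb ab by (auto simp: Z_def inner_diff_left inner_add_left)
  moreover from calculation have "a + b - z \<in> X" by (simp add: X_def)
  ultimately have "a + b - z \<in> Z" by (simp add: Z_def)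
  moreover have "- w = (a + b - z) - e1" unfolding ab2 z(2) by (simp add: scaleR_2)
  ultimately show "- w \<in> W" unfolding W_def by blast
qed (auto simp: W_def)

lemma W_unit: "w \<in> W \<Longrightarrow> w \<bullet> w = 1"
  by (erule W_cases) (auto simp: e_inner Z_inner inner_diff_left inner_diff_right)

lemma W_int: "w \<in> W \<Longrightarrow> w' \<in> W \<Longrightarrow> w \<bullet> w' \<in> \<int>"
  by (erule W_cases; erule W_cases)
     (auto simp: e_inner Z_inner inner_diff_left inner_diff_right intro: int Ints_diff)

text \<open>All of \<open>W\<close> lies in one coset of \<open>L\<close>, that of
  \<open>e1\<close>, and twice \<open>e1\<close> is the lattice vector \<open>a + b\<close>.\<close>

lemma W_add: "w \<in> W \<Longrightarrow> w' \<in> W \<Longrightarrow> w + w' \<in> L"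
proof -
  have L: "a \<in> L" "b \<in> L" using a b XD by auto
  have e: "e1 + e1 = a + b" "e1 - e2 = b" "- e1 - e1 = - (a + b)" "- e2 - e1 = - a" "e2 - e1 = - b"
    by (simp_all add: e1_def e2_def vec_eq_iff field_simps)
  have H: "w - e1 \<in> L" if "w \<in> W" for w
    using that
  proof (rule W_cases)
    fix z assume z: "z \<in> Z" "w = z - e1"
    have "w - e1 = z - (a + b)" unfolding z(2) e(1)[symmetric] by simp
    then show ?thesis using Z_inner(6)[OF z(1)] L by (simp only:) (intro lattice_diff[OF lat] lattice_add[OF lat])
  qed (use L lattice_zero[OF lat] lattice_minus[OF lat] lattice_add[OF lat] in \<open>simp_all only: e diff_self\<close>)
  assume "w \<in> W" "w' \<in> W"
  have "w + w' = (w - e1) + (w' - e1) + (a + b)" unfolding e(1)[symmetric] by simp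
  then show ?thesis using H[OF \<open>w \<in> W\<close>] H[OF \<open>w' \<in> W\<close>] L
    by (simp only:) (intro lattice_add[OF lat])
qed

end

theorem isometric_E8: "isometric L E8_lattice"
proof -
  obtain a b where ab: "a \<in> X" "b \<in> X" "a \<bullet> b = 0" by (rule orthogonal_roots)
  obtain p :: "8 \<Rightarrow> real ^ 'n" where p: "\<And>i. p i \<in> W a b" "\<And>i j. p i \<bullet> p j = (if i = j then 1 else 0)"
  proof (rule orthonormal_frame[where 'i = 8, of "W a b"])
    show "card (W a b) = 2 * CARD(8)" using card_W[OF ab] by simp
  qed (use finite_W[OF ab] W_minus[OF ab] W_unit[OF ab] W_int[OF ab] in auto)
  \<comment> \<open>If all inner products with \<open>p 0\<close> were integers, their fourth powers
    would dominate their squares, but the moments are 36 and 60.\<close>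
  have "\<exists>v\<in>X. v \<bullet> p 0 \<notin> \<int>"
  proof (rule ccontr)
    assume "\<not> ?thesis"
    then have "(\<Sum>x\<in>X. (x \<bullet> p 0)\<^sup>2) \<le> (\<Sum>x\<in>X. (x \<bullet> p 0) ^ 4)"
      by (intro sum_mono Ints_square_le_power4) auto
    then show False unfolding M2 M4 by (simp add: p(2))
  qed
  then obtain v where v: "v \<in> X" "v \<bullet> p 0 \<notin> \<int>" by blast
  have "p i + p j \<in> L" "p i - p j \<in> L" for i j
    using W_add[OF ab p(1)[of i] p(1)[of j]] W_add[OF ab p(1)[of i] W_minus[OF ab p(1)[of j]]] by auto
  then show ?thesis using isometric_E8_if_frame[OF integral dim8 p(2) _ _ XD(1)[OF v(1)] v(2)] by blast
qed

end

section \<open>The minimal vectors of \<open>E\<^sub>8\<close>\<close>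

text \<open>Toggling one fixed element exchanges the subsets of even and of odd size.\<close>

lemma card_even_subsets: "card {T :: 'a::finite set. even (card T)} = 2 ^ (CARD('a) - 1)"
proof -
  define E where "E = {T :: 'a set. even (card T)}"
  define a :: 'a where "a = undefined"
  define f where "f T = (if a \<in> T then T - {a} else insert a T)" for T
  have ff: "f (f T) = T" for T by (auto simp: f_def)
  have "card T > 0" if "a \<in> T" for T using that by (auto simp: card_gt_0_iff)
  then have par: "even (card (f T)) \<longleftrightarrow> odd (card T)" for T
    by (auto simp: f_def card_Diff_singleton)
  have "f ` E = - E"
  proof
    show "- E \<subseteq> f ` E"
    proof
      fix T assume "T \<in> - E"
      then have "f T \<in> E" using par[of T] by (simp add: E_def)
      then show "T \<in> f ` E" using ff[of T] by (metis imageI)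
    qed
  qed (auto simp: E_def par)
  moreover have "inj_on f E" by (rule inj_onI) (metis ff)
  ultimately have "card (- E) = card E" by (metis card_image)
  moreover have "card E + card (- E) = card (UNIV :: 'a set set)"
    by (subst card_Un_disjoint[symmetric]) auto
  moreover have "card (UNIV :: 'a set set) = 2 ^ CARD('a)" by (metis Pow_UNIV card_Pow finite_class.finite_UNIV)
  moreover have "(2::nat) ^ CARD('a) = 2 * 2 ^ (CARD('a) - 1)"
    by (metis One_nat_def Suc_pred power_Suc zero_less_card_finite)
  ultimately show ?thesis by (simp add: E_def)
qed

text \<open>\<open>S\<close> is the support and \<open>T\<close>, taken inside \<open>S\<close>, the
  set of positions of the entries -1.\<close>

definition int_root :: "8 set \<Rightarrow> 8 set \<Rightarrow> real ^ 8" where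
  "int_root S T = (\<chi> i. indicator S i - 2 * indicator T i)"

definition half_root :: "8 set \<Rightarrow> real ^ 8" where
  "half_root T = (\<chi> i. 1 / 2 - indicator T i)"

lemma sum_indicator_8: "(\<Sum>i\<in>UNIV. indicator S i :: real) = real (card (S :: 8 set))"
  unfolding indicator_def of_bool_def by (simp add: sum.If_cases)

lemma norm2_sum: "(norm (y :: real ^ 'n))\<^sup>2 = (\<Sum>i\<in>UNIV. (y $ i)\<^sup>2)"
  unfolding power2_norm_eq_inner inner_vec_def by (simp add: power2_eq_square)

text \<open>Integral roots have entries in \<open>{-1, 0, 1}\<close>, two of them nonzero. In a
  half-odd root each of the eight squares is at least 1/4 and they sum to 2, so all equal 1/4; the
  coordinate sum is then even exactly when the number of minus signs is.\<close>

lemma E8_roots: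
  "{y \<in> E8_lattice. (norm y)\<^sup>2 = 2} =
     (\<lambda>(S, T). int_root S T) ` (SIGMA S : {S. card S = 2}. Pow S) \<union> half_root ` {T. even (card T)}"
proof (intro set_eqI iffI)
  fix y :: "real ^ 8"
  assume "y \<in> {y \<in> E8_lattice. (norm y)\<^sup>2 = 2}"
  then obtain m :: int where y: "(\<forall>i. y $ i \<in> \<int>) \<or> (\<forall>i. y $ i - 1 / 2 \<in> \<int>)"
      "(\<Sum>i\<in>UNIV. y $ i) = 2 * of_int m" and n: "(\<Sum>i\<in>UNIV. (y $ i)\<^sup>2) = 2"
    by (auto simp: E8_lattice_def norm2_sum)
  from y(1) show "y \<in> (\<lambda>(S, T). int_root S T) ` (SIGMA S : {S. card S = 2}. Pow S) \<union> half_root ` {T. even (card T)}"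
  proof
    assume Z: "\<forall>i. y $ i \<in> \<int>"
    have val: "y $ i \<in> {-1, 0, 1}" for i
    proof -
      obtain l :: int where l: "y $ i = of_int l" using Z by (metis Ints_cases)
      have "(y $ i)\<^sup>2 \<le> 2" using member_le_sum[of i UNIV "\<lambda>i. (y $ i)\<^sup>2"] n by simp
      then have "\<bar>y $ i\<bar> < 2"
        using abs_le_square_iff[of 2 "y $ i"] by (simp add: not_le[symmetric])
      then have "\<bar>l\<bar> < 2" using l by linarith
      then have "l \<in> {-1, 0, 1}" by auto
      then show ?thesis using l by auto
    qed
    define S T where "S = {i. y $ i \<noteq> 0}" and "T = {i. y $ i = -1}"
    have "y = int_root S T"
      unfolding vec_eq_iff
    proof
      fix i show "y $ i = int_root S T $ i"
        using val[of i] by (auto simp: int_root_def S_def T_def)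
    qed
    moreover have "real (card S) = (\<Sum>i\<in>UNIV. (y $ i)\<^sup>2)"
      unfolding sum_indicator_8[symmetric]
    proof (rule sum.cong)
      fix i show "indicator S i = (y $ i)\<^sup>2" using val[of i] by (auto simp: S_def)
    qed simp
    then have "card S = 2" using n by simp
    moreover have "T \<subseteq> S" by (auto simp: S_def T_def)
    ultimately show ?thesis by auto
  next
    assume half: "\<forall>i. y $ i - 1 / 2 \<in> \<int>"
    have ge: "(y $ i)\<^sup>2 - 1 / 4 \<ge> 0" for i
    proof -
      obtain l :: int where "y $ i - 1 / 2 = of_int l" using half by (metis Ints_cases)
      then have "y $ i = of_int l + 1 / 2" by simp
      then have "(y $ i)\<^sup>2 - 1 / 4 = of_int (l * (l + 1))" by (simp add: power2_eq_square algebra_simps)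
      moreover have "l * (l + 1) \<ge> 0" by (cases "l \<ge> 0") (auto intro: mult_nonpos_nonpos)
      ultimately show ?thesis by (metis of_int_0_le_iff)
    qed
    have "(\<Sum>i\<in>UNIV. (y $ i)\<^sup>2 - 1 / 4) = 0" using n by (simp add: sum_subtractf)
    then have "(y $ i)\<^sup>2 - 1 / 4 = 0" for i using ge by (subst (asm) sum_nonneg_eq_0_iff) auto
    then have "(y $ i)\<^sup>2 = (1 / 2)\<^sup>2" for i by (simp add: power2_eq_square)
    then have val: "y $ i = 1 / 2 \<or> y $ i = - (1 / 2)" for i by (simp only: power2_eq_iff)
    define T where "T = {i. y $ i = - (1 / 2)}"
    have eq: "y = half_root T"
      unfolding vec_eq_iff
    proof
      fix i show "y $ i = half_root T $ i" using val[of i] by (auto simp: half_root_def T_def)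
    qed
    have "2 * of_int m = 4 - real (card T)"
      using y(2) unfolding eq half_root_def by (simp add: sum_subtractf sum_indicator_8)
    then have "real_of_int (int (card T)) = of_int (2 * (2 - m))" by simp
    then have "int (card T) = 2 * (2 - m)" by (simp only: of_int_eq_iff)
    then have "even (card T)" by (metis dvd_triv_left even_of_nat)
    then show ?thesis using eq by blast
  qed
next
  fix y :: "real ^ 8"
  assume "y \<in> (\<lambda>(S, T). int_root S T) ` (SIGMA S : {S. card S = 2}. Pow S) \<union> half_root ` {T. even (card T)}"
  then show "y \<in> {y \<in> E8_lattice. (norm y)\<^sup>2 = 2}"
  proof
    assume "y \<in> (\<lambda>(S, T). int_root S T) ` (SIGMA S : {S. card S = 2}. Pow S)"
    then obtain S T where ST: "card S = 2" "T \<subseteq> S" and y: "y = int_root S T" by auto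
    have "(norm y)\<^sup>2 = (\<Sum>i\<in>UNIV. indicator S i)"
      unfolding norm2_sum y using ST(2) by (intro sum.cong) (auto simp: int_root_def indicator_def)
    then have "(norm y)\<^sup>2 = 2" by (simp add: sum_indicator_8 ST(1))
    moreover have "(\<Sum>i\<in>UNIV. y $ i) = 2 * of_int (1 - int (card T))"
      unfolding y int_root_def
      by (simp add: sum_subtractf sum_distrib_left[symmetric] sum_indicator_8 ST(1))
    then have "\<exists>m::int. (\<Sum>i\<in>UNIV. y $ i) = 2 * of_int m" by blast
    moreover have "y $ i \<in> \<int>" for i by (auto simp: y int_root_def indicator_def)
    ultimately show ?thesis by (simp add: E8_lattice_def)
  next
    assume "y \<in> half_root ` {T. even (card T)}"
    then obtain T where T: "even (card T)" and y: "y = half_root T" by auto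
    have "(norm y)\<^sup>2 = (\<Sum>i\<in>(UNIV :: 8 set). 1 / 4)"
      unfolding norm2_sum y by (intro sum.cong) (auto simp: half_root_def indicator_def power2_eq_square)
    then have "(norm y)\<^sup>2 = 2" by simp
    moreover obtain c where c: "card T = 2 * c" using T by blast
    have "(\<Sum>i\<in>UNIV. y $ i) = 2 * of_int (2 - int c)"
      unfolding y half_root_def by (simp add: sum_subtractf sum_indicator_8 c)
    then have "\<exists>m::int. (\<Sum>i\<in>UNIV. y $ i) = 2 * of_int m" by blast
    moreover have "y $ i - 1 / 2 \<in> \<int>" for i by (auto simp: y half_root_def indicator_def)
    ultimately show ?thesis by (simp add: E8_lattice_def)
  qed
qed

lemma choose_8_2: "8 choose 2 = (28::nat)" and choose_10_3: "10 choose 3 = (120::nat)"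
  by code_simp+

text \<open>28 supports with 4 sign patterns each, and \<open>2 ^ 7\<close> even sets of minus
  signs; any single coordinate tells the two kinds apart.\<close>

lemma num_vectors_E8: "num_vectors E8_lattice 2 = 240"
proof -
  let ?A = "SIGMA S : {S :: 8 set. card S = 2}. Pow S" and ?B = "{T :: 8 set. even (card T)}"
  let ?I = "(\<lambda>(S, T). int_root S T) ` ?A" and ?H = "half_root ` ?B"
  have "inj_on (\<lambda>(S, T). int_root S T) ?A"
  proof (rule inj_onI, clarify)
    fix S T S' T' :: "8 set"
    assume sub: "T \<subseteq> S" "T' \<subseteq> S'" and eq: "int_root S T = int_root S' T'"
    have "(i \<in> S \<longleftrightarrow> i \<in> S') \<and> (i \<in> T \<longleftrightarrow> i \<in> T')" for i
    proof -
      have "(indicator S i - 2 * indicator T i :: real) = indicator S' i - 2 * indicator T' i"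
        using eq by (simp add: vec_eq_iff int_root_def)
      then show ?thesis using sub
        by (cases "i \<in> S"; cases "i \<in> S'"; cases "i \<in> T"; cases "i \<in> T'") auto
    qed
    then show "S = S' \<and> T = T'" by blast
  qed
  then have "card ?I = card ?A" by (rule card_image)
  also have "\<dots> = (\<Sum>S | card (S :: 8 set) = 2. 2 ^ card S)" by (simp add: card_SigmaI card_Pow)
  also have "\<dots> = 4 * card {S :: 8 set. card S = 2}" by simp
  also have "card {S :: 8 set. card S = 2} = 8 choose 2"
    using n_subsets[of "UNIV :: 8 set" 2] by simp
  finally have I: "card ?I = 112" by (simp add: choose_8_2)
  have "inj_on half_root ?B"
  proof (rule inj_onI)
    fix T T' assume "half_root T = half_root T'"
    then have eq: "(indicator T i :: real) = indicator T' i" for i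
      by (simp add: vec_eq_iff half_root_def)
    have "i \<in> T \<longleftrightarrow> i \<in> T'" for i
      using eq[of i] by (cases "i \<in> T"; cases "i \<in> T'") auto
    then show "T = T'" by blast
  qed
  then have "card ?H = card ?B" by (rule card_image)
  then have H: "card ?H = 128" by (simp add: card_even_subsets)
  have "int_root S T \<noteq> half_root T'" for S T T'
  proof
    assume "int_root S T = half_root T'"
    then have "(indicator S 0 - 2 * indicator T 0 :: real) = 1 / 2 - indicator T' 0"
      by (simp add: vec_eq_iff int_root_def half_root_def)
    then show False by (cases "0 \<in> S"; cases "0 \<in> T"; cases "0 \<in> T'") auto
  qed
  then have "?I \<inter> ?H = {}" by auto
  then have "card (?I \<union> ?H) = card ?I + card ?H" by (intro card_Un_disjoint) auto
  then show ?thesis unfolding num_vectors_def using I H E8_roots by simp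
qed

section \<open>The classification\<close>

lemma extremal_lattice_half:
  fixes L :: "(real ^ 'n) set"
  assumes "integral_lattice L" "k \<ge> 1"
    and num: "num_vectors L k = 2 * ((CARD('n) + 2 * k - 2) choose (2 * k - 1))"
  obtains Y where "extremal_half Y k" "{x \<in> L. x \<bullet> x = real k} = Y \<union> uminus ` Y" "Y \<inter> uminus ` Y = {}"
proof -
  define X where "X = {x \<in> L. x \<bullet> x = real k}"
  have lat: "is_lattice L" and int: "\<And>x y. x \<in> L \<Longrightarrow> y \<in> L \<Longrightarrow> x \<bullet> y \<in> \<int>"
    using assms(1) by (auto simp: integral_lattice_def)
  have card: "card X = 2 * ((CARD('n) + 2 * k - 2) choose (2 * k - 1))"
    using num by (simp add: num_vectors_def X_def power2_norm_eq_inner)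
  have "CARD('n) > 0" by simp
  then have "2 * k - 1 \<le> CARD('n) + 2 * k - 2" by linarith
  \<comment> \<open>Infinite sets have \<open>card\<close> 0, so positivity of the binomial
    coefficient yields finiteness of \<open>X\<close>.\<close>
  then have "card X > 0" unfolding card by simp
  then have "finite X" by (rule card_ge_0_finite)
  moreover have "0 \<notin> X" using assms(2) by (simp add: X_def)
  moreover have "- x \<in> X" if "x \<in> X" for x using that lattice_minus[OF lat] by (auto simp: X_def)
  ultimately obtain Y where Y: "Y \<subseteq> X" "X = Y \<union> uminus ` Y" "Y \<inter> uminus ` Y = {}" "card X = 2 * card Y"
    using antipodal_half by blast
  have "extremal_half Y k"
  proof
    show "finite Y" using Y(1) \<open>finite X\<close> by (rule finite_subset)
    show "card Y = (CARD('n) + 2 * k - 2) choose (2 * k - 1)" using Y(4) card by simp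
    show "y \<bullet> z \<in> \<int>" if "y \<in> Y" "z \<in> Y" for y z using that Y(1) int by (auto simp: X_def)
    show "- y \<notin> Y" if "y \<in> Y" for y using that Y(3) by (metis disjoint_iff imageI)
  qed (use assms(2) Y(1) in \<open>auto simp: X_def\<close>)
  then show ?thesis using that Y(2,3) by (simp add: X_def)
qed

text \<open>The count 240 is the extremal value \<open>2 * (10 choose 3)\<close>. From
  \<open>card Y = 120\<close>, \<open>moment_recursion\<close> yields the second and fourth moments,
  which double in passing from \<open>Y\<close> to \<open>X\<close>.\<close>

lemma E8_if_240_roots:
  fixes L :: "(real ^ 'n) set"
  assumes "integral_lattice L" "CARD('n) = 8" "num_vectors L 2 = 240"
  shows "isometric L E8_lattice"
proof -
  define X where "X = {x \<in> L. x \<bullet> x = 2}"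
  obtain Y where Y: "extremal_half Y 2" "X = Y \<union> uminus ` Y" "Y \<inter> uminus ` Y = {}"
    using extremal_lattice_half[of L 2] assms by (auto simp: X_def choose_10_3)
  interpret extremal_half Y 2 by (rule Y)
  have cardY: "card Y = 120" using card_Y assms(2) by (simp add: choose_10_3)
  have m2: "(\<Sum>y\<in>Y. (y \<bullet> u)\<^sup>2) = 30 * (u \<bullet> u)" for u
    using moment_recursion[of 0 u] by (simp add: cardY assms(2) power2_eq_square)
  have m4: "(\<Sum>y\<in>Y. (y \<bullet> u) ^ 4) = 18 * (u \<bullet> u)\<^sup>2" for u
  proof -
    have "6 * (30 * (u \<bullet> u)) * (u \<bullet> u) = 10 * (\<Sum>y\<in>Y. (y \<bullet> u) ^ 4)"
      using moment_recursion[of 1 u] m2[of u] assms(2) by simp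
    then show ?thesis by (simp add: power2_eq_square)
  qed
  have double: "(\<Sum>x\<in>X. (x \<bullet> u) ^ (2 * p)) = 2 * (\<Sum>y\<in>Y. (y \<bullet> u) ^ (2 * p))" for u p
  proof -
    have "(\<Sum>x\<in>X. (x \<bullet> u) ^ (2 * p)) = (\<Sum>y\<in>Y. (y \<bullet> u) ^ (2 * p)) + (\<Sum>y\<in>uminus ` Y. (y \<bullet> u) ^ (2 * p))"
      unfolding Y(2) using finite_Y Y(3) by (intro sum.union_disjoint) auto
    also have "(\<Sum>y\<in>uminus ` Y. (y \<bullet> u) ^ (2 * p)) = (\<Sum>y\<in>Y. (y \<bullet> u) ^ (2 * p))"
      by (subst sum.reindex) (auto simp: inj_on_def power_mult)
    finally show ?thesis by simp
  qed
  have "roots_240 L X"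
  proof
    show "card X = 240" using assms(3) by (simp add: num_vectors_def X_def power2_norm_eq_inner)
    show "(\<Sum>x\<in>X. (x \<bullet> u)\<^sup>2) = 60 * (u \<bullet> u)" for u using double[of u 1] m2[of u] by simp
    show "(\<Sum>x\<in>X. (x \<bullet> u) ^ 4) = 36 * (u \<bullet> u)\<^sup>2" for u using double[of u 2] m4[of u] by simp
  qed (use assms X_def in auto)
  then show ?thesis by (rule roots_240.isometric_E8)
qed

theorem theorem1p1:
  fixes L :: "(real ^ 'n) set" and k :: nat
  assumes "integral_lattice L" and "full_rank L" and "k \<ge> 1"
  shows "(num_vectors L k = 2 * ((CARD('n) + 2 * k - 2) choose (2 * k - 1))
            \<longleftrightarrow> case_line L k \<or> case_Zn L k \<or> case_E8 L k)
       \<and> \<not> (case_line L k \<and> case_Zn L k)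
       \<and> \<not> (case_line L k \<and> case_E8 L k)
       \<and> \<not> (case_Zn L k \<and> case_E8 L k)
       \<and> (CARD('n) = 1 \<longrightarrow> (case_line L k \<longleftrightarrow> represents L k))"
proof -
  \<comment> \<open>In dimension one the bound is 2, attained by a vector of squared norm
    \<open>k\<close> and its negative as soon as one exists.\<close>
  have line: "(case_line L k \<longleftrightarrow> represents L k) \<and> (num_vectors L k = 2 \<longleftrightarrow> represents L k)"
    if n: "CARD('n) = 1"
  proof -
    obtain a where a: "a > 0" "a\<^sup>2 \<in> \<int>" "L = line_lattice a"
      using line_lattice_cases[OF assms(1,2) n] by blast
    have "case_line L k \<Longrightarrow> represents L k"
      using represents_line_lattice[OF n] by (auto simp: case_line_def)
    moreover have "represents L k \<Longrightarrow> case_line L k"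
      using represents_line_lattice[OF n] a n by (auto simp: case_line_def)
    moreover have "num_vectors L k = 2 \<longleftrightarrow> represents L k"
      using num_vectors_line_lattice[OF n a(1) assms(3)] represents_line_lattice[OF n] a(3) by blast
    ultimately show ?thesis by blast
  qed
  have "num_vectors L k = 2 * ((CARD('n) + 2 * k - 2) choose (2 * k - 1))
      \<longleftrightarrow> case_line L k \<or> case_Zn L k \<or> case_E8 L k"
  proof (cases "CARD('n) = 1")
    case True
    then have "(CARD('n) + 2 * k - 2) choose (2 * k - 1) = 1" using assms(3) by simp
    moreover have "\<not> case_Zn L k" "\<not> case_E8 L k" using True by (auto simp: case_Zn_def case_E8_def)
    ultimately show ?thesis using line[OF True] by simp
  next
    case False
    have "CARD('n) > 0" by simp
    then have n: "CARD('n) \<ge> 2" using False by linarith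
    have "case_Zn L k \<or> case_E8 L k"
      if num: "num_vectors L k = 2 * ((CARD('n) + 2 * k - 2) choose (2 * k - 1))"
    proof (cases "k = 1")
      case True
      then have "num_vectors L 1 = 2 * CARD('n)" using num by simp
      then show ?thesis using unit_vectors_imp_isometric_Z[OF assms(1)] True n by (simp add: case_Zn_def)
    next
      case False
      then have "k \<ge> 2" using assms(3) by simp
      obtain Y :: "(real ^ 'n) set" where Y: "extremal_half Y k"
        by (rule extremal_lattice_half[OF assms(1,3) num], rule that)
      have kn: "k = 2" "CARD('n) = 8"
        using extremal_half.dimension_and_norm[OF Y \<open>k \<ge> 2\<close> n] by auto
      then have "num_vectors L 2 = 240" using num by (simp add: choose_10_3)
      then show ?thesis using E8_if_240_roots[OF assms(1)] kn by (simp add: case_E8_def)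
    qed
    moreover have "num_vectors L k = 2 * ((CARD('n) + 2 * k - 2) choose (2 * k - 1))" if "case_Zn L k"
      using that isometric_num_vectors[of L "Z_lattice :: (real ^ 'n) set" 1] num_vectors_Z_lattice[where 'n = 'n] by (auto simp: case_Zn_def)
    moreover have "num_vectors L k = 2 * ((CARD('n) + 2 * k - 2) choose (2 * k - 1))" if "case_E8 L k"
      using that isometric_num_vectors[of L E8_lattice 2] num_vectors_E8 by (auto simp: case_E8_def choose_10_3)
    moreover have "\<not> case_line L k" using False by (simp add: case_line_def)
    ultimately show ?thesis by blast
  qed
  moreover have "\<not> (case_line L k \<and> case_Zn L k)" "\<not> (case_line L k \<and> case_E8 L k)"
      "\<not> (case_Zn L k \<and> case_E8 L k)"
    by (auto simp: case_line_def case_Zn_def case_E8_def)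
  ultimately show ?thesis using line by blast
qed

end
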